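(* Let $G$ be a group with a symmetric triangular presentation $\langle S\mid R\rangle$ and let $M$ be the associated generalized Dowling geometry. If $M$ is entropic, then there exist $n\in\mathbb N$ and a group homomorphism $\rho:G\to S_n$ with $\rho(s)\neq\rho(s')$ for all distinct $s,s'\in S$.
   Context: A presentation $\langle S\mid R\rangle$ is symmetric triangular if: $S$ and $R$ are finite and the neutral element $e$ is a generator in $S$; for every $e\neq s\in S$ also a (formal) inverse $s^{-1}\in S$, and $ss^{-1}e\in R$; all relators in $R$ are words of length three in $S$ (not necessarily reduced); if $abc\in R$ then $bca,cab\in R$ and $c^{-1}b^{-1}a^{-1}\in R$; and $eee\in R$. The generalized Dowling geometry of $\langle S\mid R\rangle$ is the simple rank-$3$ matroid on $E=\{b_1,b_2,b_3\}\cup\{s_i: s\in S,\ 1\le i\le 3\}$ (three copies of each generator) in which the rank-2 flats containing at least three elements are: $\{b_1,b_2\}\cup\{s_1\}_{s\in S}$, $\{b_2,b_3\}\cup\{s_2\}_{s\in S}$, $\{b_3,b_1\}\cup\{s_3\}_{s\in S}$, and $\{s_i,s'_j,s''_k\}$ for each relator $s''s's\in R$ and each cyclic shift $(i,j,k)$ of $(1,2,3)$; equivalently, a 3-element subset of $E$ is dependent iff it lies in one of these flats, and all sets of size at most two are independent. A matroid $M=(E,r)$ is entropic if there exist discrete random variables $\{X_e\}_{e\in E}$ and $\lambda>0$ with $r(A)=\lambda H(X_A)$ for all $A\subseteq E$ ($H$ the Shannon entropy of the joint variable $X_A$). $S_n$ is the symmetric group. *)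

theory Defs
  imports "HOL-Algebra.Sym_Groups" "HOL-Probability.Information"
begin

section \<open>Group presentations\<close>

text \<open>
  A letter \<open>(s, True)\<close> stands for the generator \<open>s\<close> and \<open>(s, False)\<close> for its inverse in the
  free group on \<open>S\<close>.
\<close>

type_synonym 's word = "('s \<times> bool) list"

abbreviation words :: "'s set \<Rightarrow> 's word set" where
  "words S \<equiv> lists (S \<times> UNIV)"

definition pos_word :: "'s list \<Rightarrow> 's word" where
  "pos_word = map (\<lambda>s. (s, True))"

inductive_set pres_rel :: "'s set \<Rightarrow> 's list set \<Rightarrow> ('s word \<times> 's word) set"
  for S :: "'s set" and R :: "'s list set" where
  refl: "w \<in> words S \<Longrightarrow> (w, w) \<in> pres_rel S R"
| sym: "(v, w) \<in> pres_rel S R \<Longrightarrow> (w, v) \<in> pres_rel S R"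
| trans: "(u, v) \<in> pres_rel S R \<Longrightarrow> (v, w) \<in> pres_rel S R \<Longrightarrow> (u, w) \<in> pres_rel S R"
| cancel: "u \<in> words S \<Longrightarrow> v \<in> words S \<Longrightarrow> s \<in> S \<Longrightarrow>
    (u @ [(s, b), (s, \<not> b)] @ v, u @ v) \<in> pres_rel S R"
| relator: "u \<in> words S \<Longrightarrow> v \<in> words S \<Longrightarrow> r \<in> R \<Longrightarrow> set r \<subseteq> S \<Longrightarrow>
    (u @ pos_word r @ v, u @ v) \<in> pres_rel S R"

text \<open>
  The group \<open>\<langle>S | R\<rangle>\<close>, for relators that are words in the generators (without inverse letters).
\<close>

definition presented_group :: "'s set \<Rightarrow> 's list set \<Rightarrow> 's word set monoid" where
  "presented_group S R =
    \<lparr> carrier = words S // pres_rel S R,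
      mult = (\<lambda>A B. \<Union>a\<in>A. \<Union>b\<in>B. pres_rel S R `` {a @ b}),
      one = pres_rel S R `` {[]} \<rparr>"

text \<open>
  \<open>G\<close> is the group \<open>\<langle>S | R\<rangle>\<close>, where \<open>\<iota> s\<close> is the element of \<open>G\<close> given by the generator \<open>s\<close>.
  The map \<open>\<iota>\<close> need not be injective on \<open>S\<close>.
\<close>

definition has_presentation ::
    "('g, 'b) monoid_scheme \<Rightarrow> ('s \<Rightarrow> 'g) \<Rightarrow> 's set \<Rightarrow> 's list set \<Rightarrow> bool" where
  "has_presentation G \<iota> S R \<longleftrightarrow> group G \<and>
    (\<exists>\<psi> \<in> iso (presented_group S R) G. \<forall>s\<in>S. \<psi> (pres_rel S R `` {pos_word [s]}) = \<iota> s)"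

lemma pres_rel_words: "(v, w) \<in> pres_rel S R \<Longrightarrow> v \<in> words S \<and> w \<in> words S"
  by (induction rule: pres_rel.induct) (auto simp: pos_word_def)

lemma equiv_pres_rel: "equiv (words S) (pres_rel S R)"
proof (rule equivI)
  show "pres_rel S R \<subseteq> words S \<times> words S"
    using pres_rel_words by fastforce
  show "refl_on (words S) (pres_rel S R)"
    by (auto simp: refl_on_def intro: pres_rel.refl)
  show "sym (pres_rel S R)"
    by (rule symI) (rule pres_rel.sym)
  show "trans (pres_rel S R)"
    by (rule transI) (rule pres_rel.trans)
qed

lemma pres_rel_ctxt:
  assumes "(v, w) \<in> pres_rel S R" "x \<in> words S" "y \<in> words S"
  shows "(x @ v @ y, x @ w @ y) \<in> pres_rel S R"
  using assms
proof (induction rule: pres_rel.induct)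
  case (cancel u v s b)
  then show ?case
    using pres_rel.cancel[of "x @ u" S "v @ y" s b R] by simp
next
  case (relator u v r)
  then show ?case
    using pres_rel.relator[of "x @ u" S "v @ y" r R] by simp
next
  case (refl w)
  then show ?case by (intro pres_rel.refl) simp
next
  case (sym v w)
  show ?case by (rule pres_rel.sym[OF sym.IH[OF sym.prems]])
next
  case (trans u v w)
  show ?case by (rule pres_rel.trans[OF trans.IH(1)[OF trans.prems] trans.IH(2)[OF trans.prems]])
qed

lemma pres_rel_append:
  assumes "(a, a') \<in> pres_rel S R" "(b, b') \<in> pres_rel S R"
  shows "(a @ b, a' @ b') \<in> pres_rel S R"
proof -
  have "(a @ b, a' @ b) \<in> pres_rel S R"
    using pres_rel_ctxt[OF assms(1), of "[]" b] pres_rel_words[OF assms(2)] by simp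
  moreover have "(a' @ b, a' @ b') \<in> pres_rel S R"
    using pres_rel_ctxt[OF assms(2), of a' "[]"] pres_rel_words[OF assms(1)] by simp
  ultimately show ?thesis by (rule pres_rel.trans)
qed

lemma presented_group_mult:
  assumes "a \<in> words S" "b \<in> words S"
  shows "pres_rel S R `` {a} \<otimes>\<^bsub>presented_group S R\<^esub> pres_rel S R `` {b} = pres_rel S R `` {a @ b}"
proof -
  let ?r = "pres_rel S R"
  have eq: "?r `` {a' @ b'} = ?r `` {a @ b}" if "a' \<in> ?r `` {a}" "b' \<in> ?r `` {b}" for a' b'
    using that equiv_class_eq[OF equiv_pres_rel pres_rel_append] by blast
  have "?r `` {a} \<noteq> {}" "?r `` {b} \<noteq> {}"
    using assms pres_rel.refl by blast+
  then have "(\<Union>a'\<in>?r `` {a}. \<Union>b'\<in>?r `` {b}. ?r `` {a @ b}) = ?r `` {a @ b}"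
    by simp
  then show ?thesis
    unfolding presented_group_def by (simp add: eq cong: SUP_cong_simp)
qed

lemma pres_rel_inverse:
  "w \<in> words S \<Longrightarrow> (rev (map (\<lambda>(s, b). (s, \<not> b)) w) @ w, []) \<in> pres_rel S R"
proof (induction w)
  case Nil
  then show ?case by (auto intro: pres_rel.refl)
next
  case (Cons x w)
  obtain s b where x: "x = (s, b)" by fastforce
  let ?v = "rev (map (\<lambda>(s, b). (s, \<not> b)) w)"
  have "?v \<in> words S" "w \<in> words S" "s \<in> S"
    using Cons.prems x by auto
  then have "(?v @ [(s, \<not> b), (s, \<not> \<not> b)] @ w, ?v @ w) \<in> pres_rel S R"
    by (intro pres_rel.cancel)
  from pres_rel.trans[OF this Cons.IH[OF \<open>w \<in> words S\<close>]] show ?case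
    by (simp add: x)
qed

lemma group_presented_group: "group (presented_group S R)"
proof (rule groupI)
  have carr: "carrier (presented_group S R) = words S // pres_rel S R"
    and one: "\<one>\<^bsub>presented_group S R\<^esub> = pres_rel S R `` {[]}"
    by (simp_all add: presented_group_def)
  fix x assume "x \<in> carrier (presented_group S R)"
  then obtain a where a: "a \<in> words S" "x = pres_rel S R `` {a}"
    by (metis carr quotientE)
  show "\<one>\<^bsub>presented_group S R\<^esub> \<otimes>\<^bsub>presented_group S R\<^esub> x = x"
    using a by (simp add: one presented_group_mult)
  let ?a' = "rev (map (\<lambda>(s, b). (s, \<not> b)) a)"
  have "?a' \<in> words S" using a by auto
  then show "\<exists>y\<in>carrier (presented_group S R). y \<otimes>\<^bsub>presented_group S R\<^esub> x = \<one>\<^bsub>presented_group S R\<^esub>"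
    using a equiv_class_eq[OF equiv_pres_rel pres_rel_inverse[OF a(1)]]
    by (intro bexI[of _ "pres_rel S R `` {?a'}"])
       (simp_all add: one carr presented_group_mult quotientI)
  fix y assume "y \<in> carrier (presented_group S R)"
  then obtain b where b: "b \<in> words S" "y = pres_rel S R `` {b}"
    by (metis carr quotientE)
  show "x \<otimes>\<^bsub>presented_group S R\<^esub> y \<in> carrier (presented_group S R)"
    using a b by (simp add: carr presented_group_mult quotientI)
  fix z assume "z \<in> carrier (presented_group S R)"
  then obtain c where c: "c \<in> words S" "z = pres_rel S R `` {c}"
    by (metis carr quotientE)
  show "x \<otimes>\<^bsub>presented_group S R\<^esub> y \<otimes>\<^bsub>presented_group S R\<^esub> z =
      x \<otimes>\<^bsub>presented_group S R\<^esub> (y \<otimes>\<^bsub>presented_group S R\<^esub> z)"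
    using a b c by (simp add: presented_group_mult)
qed (simp add: presented_group_def quotientI)

text \<open>
  Formal inversion is an involution \<open>sinv\<close> of the set \<open>S\<close>, with \<open>e\<inverse> = e\<close>; the latter
  gives a meaning to the inverted relators that contain \<open>e\<close>. A generator may be its own formal
  inverse.

  These conditions do not force \<open>e\<close> to be trivial in \<open>\<langle>S | R\<rangle>\<close>: sending every generator
  to \<open>1\<close> in \<open>\<int>/3\<int>\<close> respects all relators of length three. That \<open>e\<close> denotes the neutral element
  is an additional relator \<open>[e]\<close>, so the group presented by such data is
  \<open>presented_group S (insert [e] R)\<close>.
\<close>

definition symmetric_triangular ::
    "'s \<Rightarrow> ('s \<Rightarrow> 's) \<Rightarrow> 's set \<Rightarrow> 's list set \<Rightarrow> bool" where
  "symmetric_triangular e sinv S R \<longleftrightarrow>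
    finite S \<and> finite R \<and> e \<in> S \<and>
    sinv e = e \<and> (\<forall>s\<in>S. sinv s \<in> S \<and> sinv (sinv s) = s) \<and>
    (\<forall>s\<in>S. s \<noteq> e \<longrightarrow> [s, sinv s, e] \<in> R) \<and>
    (\<forall>w\<in>R. length w = 3 \<and> set w \<subseteq> S) \<and>
    (\<forall>a b c. [a, b, c] \<in> R \<longrightarrow>
      [b, c, a] \<in> R \<and> [c, a, b] \<in> R \<and> [sinv c, sinv b, sinv a] \<in> R) \<and>
    [e, e, e] \<in> R"

section \<open>Generalized Dowling geometries\<close>

definition matroid :: "'a set \<Rightarrow> ('a set \<Rightarrow> nat) \<Rightarrow> bool" where
  "matroid E r \<longleftrightarrow> finite E \<and>
    (\<forall>A. A \<subseteq> E \<longrightarrow> r A \<le> card A) \<and>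
    (\<forall>A B. A \<subseteq> B \<longrightarrow> B \<subseteq> E \<longrightarrow> r A \<le> r B) \<and>
    (\<forall>A B. A \<subseteq> E \<longrightarrow> B \<subseteq> E \<longrightarrow> r (A \<union> B) + r (A \<inter> B) \<le> r A + r B)"

text \<open>\<open>Base i\<close> is \<open>b\<^sub>i\<close> and \<open>Copy s i\<close> is \<open>s\<^sub>i\<close>, for \<open>i \<in> {1, 2, 3}\<close>.\<close>

datatype 's dowling_elem = Base nat | Copy 's nat

definition dowling_ground :: "'s set \<Rightarrow> 's dowling_elem set" where
  "dowling_ground S = Base ` {1, 2, 3} \<union> {Copy s i |s i. s \<in> S \<and> i \<in> {1, 2, 3}}"

definition dowling_lines :: "'s set \<Rightarrow> 's list set \<Rightarrow> 's dowling_elem set set" where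
  "dowling_lines S R =
    {{Base 1, Base 2} \<union> {Copy s 1 |s. s \<in> S},
     {Base 2, Base 3} \<union> {Copy s 2 |s. s \<in> S},
     {Base 3, Base 1} \<union> {Copy s 3 |s. s \<in> S}} \<union>
    {{Copy s i, Copy s' j, Copy s'' k} |s s' s'' i j k.
      [s'', s', s] \<in> R \<and> (i, j, k) \<in> {(1, 2, 3), (2, 3, 1), (3, 1, 2)}}"

definition dowling_indep :: "'s set \<Rightarrow> 's list set \<Rightarrow> 's dowling_elem set \<Rightarrow> bool" where
  "dowling_indep S R A \<longleftrightarrow> A \<subseteq> dowling_ground S \<and> card A \<le> 3 \<and>
    (card A = 3 \<longrightarrow> \<not> (\<exists>L \<in> dowling_lines S R. A \<subseteq> L))"

definition dowling_rank :: "'s set \<Rightarrow> 's list set \<Rightarrow> 's dowling_elem set \<Rightarrow> nat" where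
  "dowling_rank S R A = Max (card ` {I. I \<subseteq> A \<and> dowling_indep S R I})"

section \<open>Entropic matroids\<close>

definition joint_var :: "('a \<Rightarrow> 'w \<Rightarrow> 'v) \<Rightarrow> 'a set \<Rightarrow> 'w \<Rightarrow> 'a \<Rightarrow> 'v" where
  "joint_var X A = (\<lambda>\<omega>. restrict (\<lambda>a. X a \<omega>) A)"

definition discrete_random_variable :: "'w measure \<Rightarrow> ('w \<Rightarrow> 'v) \<Rightarrow> bool" where
  "discrete_random_variable P Y \<longleftrightarrow>
    Y \<in> P \<rightarrow>\<^sub>M count_space UNIV \<and> countable (Y ` space P)"

text \<open>
  Countably infinite ranges are allowed. The integral defining \<open>entropy\<close> defaults to \<open>0\<close> when
  it diverges, so \<open>H(Y) = h\<close> for a real number \<open>h\<close> includes that the entropy is finite.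
\<close>

definition has_shannon_entropy :: "'w measure \<Rightarrow> ('w \<Rightarrow> 'v) \<Rightarrow> real \<Rightarrow> bool" where
  "has_shannon_entropy P Y h \<longleftrightarrow>
    (\<exists>f. information_space.finite_entropy P 2 (count_space (Y ` space P)) Y f) \<and>
    prob_space.entropy P 2 (count_space (Y ` space P)) Y = h"

text \<open>
  HOL cannot quantify over the type \<open>'w\<close> of outcomes and the type \<open>'v\<close> of values inside a formula,
  so they are parameters; a theorem with this hypothesis for type variables \<open>'w\<close>, \<open>'v\<close> covers all
  probability spaces and all value types.
\<close>

definition entropic ::
    "'w itself \<Rightarrow> 'v itself \<Rightarrow> 'a set \<Rightarrow> ('a set \<Rightarrow> nat) \<Rightarrow> bool" where
  "entropic _ _ E r \<longleftrightarrow> matroid E r \<and>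
    (\<exists>(P :: 'w measure) (X :: 'a \<Rightarrow> 'w \<Rightarrow> 'v) (c :: real).
      prob_space P \<and> (\<forall>a\<in>E. discrete_random_variable P (X a)) \<and> c > 0 \<and>
      (\<forall>A. A \<subseteq> E \<longrightarrow>
        (\<exists>h. has_shannon_entropy P (joint_var X A) h \<and> real (r A) = c * h)))"

end

theory Submission
  imports Defs "HOL-Algebra.Bij" "HOL-Probability.Probability_Mass_Function"
begin

text \<open>
  Three variables on a line are pairwise independent and any two determine the third, so they are
  uniform on finite sets of the same size. Fixing a value of \<open>s\<^sub>i\<close> then gives a bijection from the values of
  \<open>b\<^sub>i\<close> to those of \<open>b\<^bsub>i+1\<^esub>\<close>. Fixing one outcome of \<open>e\<^sub>1, e\<^sub>2, e\<^sub>3\<close> identifies the three value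
  sets with one finite set \<open>V\<close>, and each \<open>s\<^sub>i\<close> becomes a set \<open>F\<^sub>s\<close> of permutations of \<open>V\<close> that
  does not depend on \<open>i\<close>. The line of a relator \<open>s'' s' s\<close> says that for \<open>x \<in> F\<^sub>s\<close> and
  \<open>y \<in> F\<^bsub>s'\<^esub>\<close> the inverse of \<open>y x\<close> lies in \<open>F\<^bsub>s''\<^esub>\<close>. Hence \<open>H = F\<^sub>e\<close> is a group, the \<open>F\<^sub>s\<close> are
  cosets of \<open>H\<close> in its normalizer, and \<open>s \<mapsto> F\<^sub>s\<close> is a homomorphism into a finite group. Distinct
  generators have disjoint cosets, because \<open>s\<^sub>1\<close> and \<open>s'\<^sub>1\<close> together determine \<open>b\<^sub>1\<close>.
\<close>

section \<open>Homomorphisms from presented groups\<close>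

text \<open>Von Dyck's theorem: each generating step of \<open>pres_rel\<close> preserves the value
  \<open>ev\<close> of a word in \<open>G\<close>, so evaluation descends to the classes.\<close>

lemma (in group) presented_group_hom:
  assumes f: "f \<in> S \<rightarrow> carrier G"
    and rels: "\<And>r. r \<in> R \<Longrightarrow> set r \<subseteq> S \<Longrightarrow> foldr (\<lambda>s x. f s \<otimes> x) r \<one> = \<one>"
  shows "\<exists>\<phi> \<in> hom (presented_group S R) G. \<forall>s\<in>S. \<phi> (pres_rel S R `` {pos_word [s]}) = f s"
proof -
  define ev where "ev = (\<lambda>w. foldr (\<lambda>(s, b) x. (if b then f s else inv (f s)) \<otimes> x) w \<one>)"
  have fS: "s \<in> S \<Longrightarrow> f s \<in> carrier G" for s
    using f by auto
  have ev_closed: "w \<in> words S \<Longrightarrow> ev w \<in> carrier G" for w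
    by (induction w) (auto simp: ev_def fS)
  have ev_append: "v \<in> words S \<Longrightarrow> w \<in> words S \<Longrightarrow> ev (v @ w) = ev v \<otimes> ev w" for v w
  proof (induction v)
    case Nil
    then show ?case using ev_closed by (simp add: ev_def)
  next
    case (Cons x v)
    obtain s b where x: "x = (s, b)" by fastforce
    have "ev (x # v @ w) = (if b then f s else inv (f s)) \<otimes> ev (v @ w)"
      by (simp add: ev_def x)
    then show ?case
      using Cons x fS ev_closed[of v] ev_closed[of w] by (auto simp: m_assoc ev_def)
  qed
  have ev_pos: "ev (pos_word r) = foldr (\<lambda>s x. f s \<otimes> x) r \<one>" for r
    by (induction r) (auto simp: ev_def pos_word_def)
  have resp: "(v, w) \<in> pres_rel S R \<Longrightarrow> ev v = ev w" for v w
  proof (induction rule: pres_rel.induct)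
    case (cancel u v s b)
    then have "ev [(s, b), (s, \<not> b)] = \<one>"
      by (cases b) (auto simp: ev_def fS)
    moreover have "ev (u @ [(s, b), (s, \<not> b)] @ v) = ev u \<otimes> (ev [(s, b), (s, \<not> b)] \<otimes> ev v)"
      using cancel by (simp only: ev_append lists.Cons lists.Nil SigmaI UNIV_I append_in_lists_conv)
    ultimately show ?case
      using cancel by (simp add: ev_append ev_closed)
  next
    case (relator u v r)
    then have "pos_word r \<in> words S" by (auto simp: pos_word_def)
    then show ?case
      using relator rels[of r] by (simp add: ev_append ev_closed ev_pos)
  qed auto
  \<comment> \<open>Any representative may be chosen, since \<open>resp\<close> makes
    \<open>ev\<close> constant on classes.\<close>
  define \<phi> where "\<phi> = (\<lambda>A. ev (SOME w. w \<in> A))"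
  have \<phi>: "\<phi> (pres_rel S R `` {w}) = ev w" if "w \<in> words S" for w
  proof -
    have "(SOME v. v \<in> pres_rel S R `` {w}) \<in> pres_rel S R `` {w}"
      by (rule someI[of _ w]) (simp add: pres_rel.refl that)
    then show ?thesis using resp unfolding \<phi>_def by auto
  qed
  have "\<phi> \<in> hom (presented_group S R) G"
  proof (rule homI)
    have carr: "carrier (presented_group S R) = words S // pres_rel S R"
      by (simp add: presented_group_def)
    fix x assume "x \<in> carrier (presented_group S R)"
    then obtain a where a: "a \<in> words S" "x = pres_rel S R `` {a}"
      by (metis carr quotientE)
    then show "\<phi> x \<in> carrier G" using \<phi> ev_closed by simp
    fix y assume "y \<in> carrier (presented_group S R)"
    then obtain b where b: "b \<in> words S" "y = pres_rel S R `` {b}"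
      by (metis carr quotientE)
    show "\<phi> (x \<otimes>\<^bsub>presented_group S R\<^esub> y) = \<phi> x \<otimes> \<phi> y"
      using a b by (simp add: presented_group_mult \<phi> ev_append)
  qed
  moreover have "\<phi> (pres_rel S R `` {pos_word [s]}) = f s" if "s \<in> S" for s
    using that by (subst \<phi>) (auto simp: pos_word_def ev_def fS)
  ultimately show ?thesis by blast
qed

text \<open>Von Dyck's homomorphism is composed with the inverse of the presenting isomorphism. The
  map \<open>f\<close> is given on generators and not on their images, because
  \<open>\<iota>\<close> may identify generators.\<close>

lemma has_presentation_hom:
  assumes "has_presentation G \<iota> S R" "group K" "f \<in> S \<rightarrow> carrier K"
    and "\<And>r. r \<in> R \<Longrightarrow> set r \<subseteq> S \<Longrightarrow> foldr (\<lambda>s x. f s \<otimes>\<^bsub>K\<^esub> x) r \<one>\<^bsub>K\<^esub> = \<one>\<^bsub>K\<^esub>"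
  shows "\<exists>\<phi> \<in> hom G K. \<forall>s\<in>S. \<phi> (\<iota> s) = f s"
proof -
  obtain \<phi> where \<phi>: "\<phi> \<in> hom (presented_group S R) K"
      "\<And>s. s \<in> S \<Longrightarrow> \<phi> (pres_rel S R `` {pos_word [s]}) = f s"
    using group.presented_group_hom[OF assms(2-4)] by blast
  obtain \<psi> where \<psi>: "\<psi> \<in> iso (presented_group S R) G"
      "\<And>s. s \<in> S \<Longrightarrow> \<psi> (pres_rel S R `` {pos_word [s]}) = \<iota> s"
    using assms(1) unfolding has_presentation_def by blast
  let ?\<psi>' = "inv_into (carrier (presented_group S R)) \<psi>"
  have hom: "?\<psi>' \<in> hom G (presented_group S R)"
    using group.iso_set_sym[OF group_presented_group \<psi>(1)] by (simp add: iso_def)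
  have "?\<psi>' (\<iota> s) = pres_rel S R `` {pos_word [s]}" if "s \<in> S" for s
  proof -
    have "pres_rel S R `` {pos_word [s]} \<in> carrier (presented_group S R)"
      using that by (auto simp: presented_group_def pos_word_def intro!: quotientI)
    moreover have "inj_on \<psi> (carrier (presented_group S R))"
      using \<psi>(1) by (simp add: iso_def bij_betw_def)
    ultimately show ?thesis
      using \<psi>(2)[OF that] by (metis inv_into_f_f)
  qed
  then have "(\<phi> \<circ> ?\<psi>') (\<iota> s) = f s" if "s \<in> S" for s
    using that \<phi>(2) by simp
  moreover have "\<phi> \<circ> ?\<psi>' \<in> hom G K"
    using hom \<phi>(1) by (rule hom_compose)
  ultimately show ?thesis by blast
qed

section \<open>Permutations of a finite set inside a symmetric group\<close>

lemma BijGroup_simps: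
  "carrier (BijGroup V) = Bij V" "\<one>\<^bsub>BijGroup V\<^esub> = (\<lambda>x\<in>V. x)"
  "f \<in> Bij V \<Longrightarrow> g \<in> Bij V \<Longrightarrow> f \<otimes>\<^bsub>BijGroup V\<^esub> g = compose V f g"
  by (simp_all add: BijGroup_def)

lemma finite_Bij: "finite V \<Longrightarrow> finite (Bij V)"
  by (rule finite_subset[OF _ finite_PiE[of V "\<lambda>_. V"]])
    (auto simp: Bij_def PiE_def bij_betw_def)

lemma BijGroup_embeds_in_sym_group:
  assumes "finite C"
  shows "\<exists>\<theta> \<in> hom (BijGroup C) (sym_group (card C)). inj_on \<theta> (carrier (BijGroup C))"
proof -
  obtain h where h: "bij_betw h {1..card C} C"
    using ex_bij_betw_nat_finite_1[OF assms] by blast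
  define h' where "h' = inv_into {1..card C} h"
  have h': "bij_betw h' C {1..card C}" "\<And>x. x \<in> C \<Longrightarrow> h (h' x) = x"
      "\<And>k. k \<in> {1..card C} \<Longrightarrow> h' (h k) = k"
    using h by (auto simp: h'_def bij_betw_inv_into bij_betw_inv_into_right bij_betw_inv_into_left)
  \<comment> \<open>Conjugation by the enumeration \<open>h\<close>. Elements of
    \<open>Bij C\<close> are undefined off \<open>C\<close>, while elements of
    \<open>sym_group\<close> fix every number out of range, hence the case distinction.\<close>
  define \<theta> where "\<theta> = (\<lambda>f k. if k \<in> {1..card C} then h' (f (h k)) else k)"
  have hC: "h k \<in> C" if "k \<in> {1..card C}" for k
    using h that by (auto dest: bij_betwE)
  have h'C: "h' x \<in> {1..card C}" if "x \<in> C" for x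
    using h' that by (auto dest: bij_betwE)
  have fC: "f x \<in> C" if "f \<in> Bij C" "x \<in> C" for f x
    using that by (auto simp: Bij_def dest: bij_betwE)
  have "\<theta> \<in> hom (BijGroup C) (sym_group (card C))"
  proof (rule homI)
    fix f assume "f \<in> carrier (BijGroup C)"
    then have f: "f \<in> Bij C" by (simp add: BijGroup_simps)
    then have "bij_betw (h' \<circ> f \<circ> h) {1..card C} {1..card C}"
      using h h'(1) by (auto simp: Bij_def intro!: bij_betw_trans)
    then have "bij_betw (\<theta> f) {1..card C} {1..card C}"
      by (rule bij_betw_cong[THEN iffD1, rotated]) (simp add: \<theta>_def)
    then show "\<theta> f \<in> carrier (sym_group (card C))"
      unfolding sym_group_carrier by (rule bij_imp_permutes) (auto simp: \<theta>_def)
    fix g assume "g \<in> carrier (BijGroup C)"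
    then have g: "g \<in> Bij C" by (simp add: BijGroup_simps)
    show "\<theta> (f \<otimes>\<^bsub>BijGroup C\<^esub> g) = \<theta> f \<otimes>\<^bsub>sym_group (card C)\<^esub> \<theta> g"
    proof
      fix k
      show "\<theta> (f \<otimes>\<^bsub>BijGroup C\<^esub> g) k = (\<theta> f \<otimes>\<^bsub>sym_group (card C)\<^esub> \<theta> g) k"
        using f g hC h'C[of "g (h k)"] h'(2)[of "g (h k)"] fC[OF g, of "h k"]
        by (cases "k \<in> {1..card C}")
           (auto simp: sym_group_mult BijGroup_simps \<theta>_def compose_def)
    qed
  qed
  moreover have "inj_on \<theta> (carrier (BijGroup C))"
  proof (rule inj_onI)
    fix f g assume fg: "f \<in> carrier (BijGroup C)" "g \<in> carrier (BijGroup C)" and eq: "\<theta> f = \<theta> g"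
    then have B: "f \<in> Bij C" "g \<in> Bij C" by (simp_all add: BijGroup_simps)
    show "f = g"
    proof (rule extensionalityI[of _ C])
      fix x assume x: "x \<in> C"
      have "h' (f x) = h' (g x)"
        using fun_cong[OF eq, of "h' x"] h'C[OF x] h'(2)[OF x] by (simp add: \<theta>_def)
      then show "f x = g x" using fC[OF _ x] B h'(2) by metis
    qed (use B in \<open>auto simp: Bij_def\<close>)
  qed
  ultimately show ?thesis by blast
qed

section \<open>Cosets indexed by the generators\<close>

text \<open>The cyclic successor on 1, 2, 3: \<open>(i, nxt i, nxt (nxt i))\<close> runs through the
  cyclic shifts, and \<open>nxt (nxt i)\<close> is the predecessor of \<open>i\<close>.\<close>

definition nxt :: "nat \<Rightarrow> nat" where
  "nxt i = (if i = 3 then 1 else Suc i)"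

lemma nxt_simps [simp]: "nxt 1 = 2" "nxt (Suc 0) = 2" "nxt 2 = 3" "nxt 3 = 1"
  by (simp_all add: nxt_def)

lemma nxt_closed: "i \<in> {1, 2, 3} \<Longrightarrow> nxt i \<in> {1, 2, 3}"
  by auto

lemma symmetric_triangularD:
  assumes "symmetric_triangular e sinv S R"
  shows "finite S" "e \<in> S" "sinv e = e"
    and "s \<in> S \<Longrightarrow> sinv s \<in> S" "s \<in> S \<Longrightarrow> sinv (sinv s) = s"
    and "s \<in> S \<Longrightarrow> [s, sinv s, e] \<in> R"
    and "[a, b, c] \<in> R \<Longrightarrow> [b, c, a] \<in> R" "[a, b, c] \<in> R \<Longrightarrow> [c, a, b] \<in> R"
    and "w \<in> R \<Longrightarrow> length w = 3 \<and> set w \<subseteq> S"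
proof -
  note * = assms[unfolded symmetric_triangular_def]
  show "finite S" "e \<in> S" "sinv e = e"
    and "s \<in> S \<Longrightarrow> sinv s \<in> S" "s \<in> S \<Longrightarrow> sinv (sinv s) = s"
    and "[a, b, c] \<in> R \<Longrightarrow> [b, c, a] \<in> R" "[a, b, c] \<in> R \<Longrightarrow> [c, a, b] \<in> R"
    and "w \<in> R \<Longrightarrow> length w = 3 \<and> set w \<subseteq> S"
    using * by blast+
  \<comment> \<open>The case \<open>s = e\<close> is the relator \<open>[e, e, e]\<close>, since
    \<open>sinv e = e\<close>.\<close>
  show "s \<in> S \<Longrightarrow> [s, sinv s, e] \<in> R"
    using * by metis
qed

text \<open>
  The relators force \<open>F e\<close> to be a subgroup \<open>H\<close> and every \<open>F s\<close> to be a left and right coset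
  of \<open>H\<close>. Instead of forming the quotient of the normalizer of \<open>H\<close>, let \<open>s\<close> act by \<open>A \<mapsto> F s A\<close> on
  the subsets \<open>A\<close> with \<open>H A = A\<close>.
\<close>

lemma (in group) coset_action:
  assumes fin: "finite (carrier G)"
    and tri: "symmetric_triangular e sinv S R"
    and carr: "\<And>s. s \<in> S \<Longrightarrow> F s \<subseteq> carrier G" and ne: "\<And>s. s \<in> S \<Longrightarrow> F s \<noteq> {}"
    and one: "\<one> \<in> F e"
    and inv: "\<And>s x. s \<in> S \<Longrightarrow> x \<in> F s \<Longrightarrow> inv x \<in> F (sinv s)"
    and rel: "\<And>a b c x y. [c, b, a] \<in> R \<Longrightarrow> x \<in> F a \<Longrightarrow> y \<in> F b \<Longrightarrow> inv (y \<otimes> x) \<in> F c"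
    and inj: "inj_on F S"
    and pres: "has_presentation K \<iota> S (insert [e] R)"
  shows "\<exists>(n :: nat) \<rho>. \<rho> \<in> hom K (sym_group n) \<and>
    (\<forall>s\<in>S. \<forall>s'\<in>S. s \<noteq> s' \<longrightarrow> \<rho> (\<iota> s) \<noteq> \<rho> (\<iota> s'))"
proof -
  note triD = symmetric_triangularD[OF tri]
  have cl: "x \<in> carrier G" if "s \<in> S" "x \<in> F s" for x s
    using carr that by blast
  have inv': "x \<in> F s" if "s \<in> S" "x \<in> carrier G" "inv x \<in> F (sinv s)" for x s
    using inv[OF triD(4)[OF that(1)] that(3)] that triD(5) by simp
  \<comment> \<open>Rotations of the relators \<open>[s, sinv s, e]\<close> and
    \<open>[sinv s, s, e]\<close> give in turn: \<open>F s\<close> is closed under left and right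
    multiplication by \<open>F e\<close>, and quotients within \<open>F s\<close> lie in
    \<open>F e\<close>.\<close>
  have mult_left: "h \<otimes> g \<in> F s" if "s \<in> S" "h \<in> F e" "g \<in> F s" for h g s
  proof -
    have "[sinv s, e, s] \<in> R" using triD(6,7) that(1) by blast
    then have "inv (h \<otimes> g) \<in> F (sinv s)" using rel that by blast
    moreover have "h \<otimes> g \<in> carrier G"
      using cl[OF that(1,3)] cl[OF triD(2) that(2)] by simp
    ultimately show ?thesis using inv'[OF that(1)] by simp
  qed
  have mult_right: "g \<otimes> h \<in> F s" if "s \<in> S" "h \<in> F e" "g \<in> F s" for h g s
  proof -
    have "[sinv s, s, e] \<in> R" using triD(6)[of "sinv s"] triD(4,5) that(1) by simp
    then have "inv (g \<otimes> h) \<in> F (sinv s)" using rel that by blast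
    moreover have "g \<otimes> h \<in> carrier G"
      using cl[OF that(1,3)] cl[OF triD(2) that(2)] by simp
    ultimately show ?thesis using inv'[OF that(1)] by simp
  qed
  have quot: "g \<otimes> inv g' \<in> F e" if "s \<in> S" "g \<in> F s" "g' \<in> F s" for g g' s
  proof -
    have "[e, s, sinv s] \<in> R" using triD(6,8) that(1) by blast
    then have "inv (g \<otimes> inv g') \<in> F (sinv e)" using rel that inv triD(3) by metis
    moreover have "g \<otimes> inv g' \<in> carrier G"
      using cl[OF that(1)] that(2,3) by simp
    ultimately show ?thesis using inv'[OF triD(2)] by simp
  qed
  \<comment> \<open>The members of \<open>C\<close> are the unions of right cosets of the subgroup
    \<open>F e\<close>.\<close>
  define C where "C = {A. A \<subseteq> carrier G \<and> (\<forall>h\<in>F e. \<forall>a\<in>A. h \<otimes> a \<in> A)}"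
  define act where "act s A = {g \<otimes> a |g a. g \<in> F s \<and> a \<in> A}" for s A
  have "finite C"
    by (rule finite_subset[of _ "Pow (carrier G)"]) (auto simp: C_def fin)
  have act_C: "act s A \<in> C" if s: "s \<in> S" and A: "A \<in> C" for s A
  proof -
    have A': "A \<subseteq> carrier G" using A by (simp add: C_def)
    have "h \<otimes> (g \<otimes> a) \<in> act s A" if "h \<in> F e" "g \<in> F s" "a \<in> A" for h g a
    proof -
      have "h \<in> carrier G" "g \<in> carrier G" "a \<in> carrier G"
        using that A' cl s triD(2) by blast+
      then have "h \<otimes> (g \<otimes> a) = (h \<otimes> g) \<otimes> a" by (simp add: m_assoc)
      then show ?thesis unfolding act_def using mult_left[OF s that(1,2)] that(3) by blast
    qed
    moreover have "act s A \<subseteq> carrier G"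
      using A' cl[OF s] unfolding act_def by blast
    ultimately show ?thesis unfolding C_def by (auto simp: act_def)
  qed
  have act_e: "act e A = A" if A: "A \<in> C" for A
  proof
    show "act e A \<subseteq> A" using A by (auto simp: act_def C_def)
    show "A \<subseteq> act e A"
    proof
      fix a assume a: "a \<in> A"
      then have "a = \<one> \<otimes> a" using A by (auto simp: C_def)
      then show "a \<in> act e A" unfolding act_def using one a by blast
    qed
  qed
  have act_rel: "act c (act b (act a A)) = A" if R: "[c, b, a] \<in> R" and A: "A \<in> C" for a b c A
  proof
    have S: "a \<in> S" "b \<in> S" "c \<in> S" using triD(9)[OF R] by auto
    have A': "A \<subseteq> carrier G" using A by (simp add: C_def)
    show "act c (act b (act a A)) \<subseteq> A"
    proof
      fix z assume "z \<in> act c (act b (act a A))"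
      then obtain x y w t where z: "z = w \<otimes> (y \<otimes> (x \<otimes> t))" "w \<in> F c" "y \<in> F b" "x \<in> F a" "t \<in> A"
        unfolding act_def by blast
      then have car: "w \<in> carrier G" "y \<in> carrier G" "x \<in> carrier G" "t \<in> carrier G"
        using cl S A' by blast+
      \<comment> \<open>Both \<open>w\<close> and \<open>inv (y \<otimes> x)\<close> lie in
        \<open>F c\<close>, so their quotient \<open>w \<otimes> (y \<otimes> x)\<close> lies in
        \<open>F e\<close> and preserves \<open>A\<close>.\<close>
      have "w \<otimes> inv (inv (y \<otimes> x)) \<in> F e"
        using quot[OF S(3) z(2) rel[OF R z(4,3)]] .
      then have "(w \<otimes> (y \<otimes> x)) \<otimes> t \<in> A" using A z(5) car by (auto simp: C_def)
      then show "z \<in> A" using z(1) car by (simp add: m_assoc)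
    qed
    show "A \<subseteq> act c (act b (act a A))"
    proof
      fix t assume t: "t \<in> A"
      obtain x y where xy: "x \<in> F a" "y \<in> F b" using ne S by blast
      have car: "y \<in> carrier G" "x \<in> carrier G" "t \<in> carrier G"
        using cl S A' t xy by blast+
      \<comment> \<open>The third factor \<open>inv (y \<otimes> x)\<close>, which
        \<open>rel\<close> places in \<open>F c\<close>, recovers \<open>t\<close>.\<close>
      have "t = inv (y \<otimes> x) \<otimes> (y \<otimes> (x \<otimes> t))"
        using car l_inv[of "y \<otimes> x"] by (simp add: m_assoc[symmetric] del: l_inv)
      moreover have "y \<otimes> (x \<otimes> t) \<in> act b (act a A)"
        unfolding act_def using xy t by blast
      ultimately show "t \<in> act c (act b (act a A))"
        using rel[OF R xy] unfolding act_def[of c] by blast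
    qed
  qed
  have act_inv: "act s (act (sinv s) A) = A" if "s \<in> S" "A \<in> C" for s A
    using act_rel[OF triD(6)[OF that(1)] that(2)] act_e[OF that(2)] by simp
  define f where "f = (\<lambda>s. restrict (act s) C)"
  have f: "f s \<in> Bij C" if "s \<in> S" for s
  proof -
    have "act (sinv s) (act s A) = A" if "A \<in> C" for A
      using act_inv[of "sinv s" A] triD(4,5) \<open>s \<in> S\<close> that by simp
    then have "bij_betw (act s) C C"
      using act_C[OF \<open>s \<in> S\<close>] act_C[OF triD(4)[OF \<open>s \<in> S\<close>]] act_inv[OF \<open>s \<in> S\<close>]
      by (intro bij_betwI[of _ _ _ "act (sinv s)"]) auto
    then show ?thesis unfolding f_def Bij_def by (auto cong: bij_betw_cong)
  qed
  interpret B: group "BijGroup C" by (rule group_BijGroup)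
  have f_rel: "foldr (\<lambda>s x. f s \<otimes>\<^bsub>BijGroup C\<^esub> x) r \<one>\<^bsub>BijGroup C\<^esub> = \<one>\<^bsub>BijGroup C\<^esub>"
    if r: "r \<in> insert [e] R" "set r \<subseteq> S" for r
  proof (cases "r = [e]")
    case True
    have "f e = \<one>\<^bsub>BijGroup C\<^esub>"
      by (rule ext) (simp add: f_def BijGroup_simps act_e)
    then show ?thesis using True by simp
  next
    case False
    then obtain a b c where abc: "r = [c, b, a]" "[c, b, a] \<in> R"
      using r triD(9)[of r] by (auto simp: numeral_3_eq_3 length_Suc_conv)
    then have S: "a \<in> S" "b \<in> S" "c \<in> S" using triD(9)[OF abc(2)] by auto
    have "compose C (f c) (compose C (f b) (f a)) = (\<lambda>A\<in>C. A)"
      using S act_C act_rel[OF abc(2)] by (intro ext) (simp add: f_def compose_def)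
    then show ?thesis
      using S f f[THEN B.r_one[unfolded BijGroup_simps]]
      by (simp add: abc(1) BijGroup_simps compose_Bij)
  qed
  obtain \<phi> where \<phi>: "\<phi> \<in> hom K (BijGroup C)" "\<And>s. s \<in> S \<Longrightarrow> \<phi> (\<iota> s) = f s"
    using has_presentation_hom[OF pres group_BijGroup _ f_rel] f
    by (metis BijGroup_simps(1) Pi_I)
  obtain \<theta> where \<theta>: "\<theta> \<in> hom (BijGroup C) (sym_group (card C))" "inj_on \<theta> (Bij C)"
    using BijGroup_embeds_in_sym_group[OF \<open>finite C\<close>] by (auto simp: BijGroup_simps)
  \<comment> \<open>The actions are told apart at the point \<open>F e\<close> of \<open>C\<close>,
    which \<open>act s\<close> sends to \<open>F s\<close>.\<close>
  have f_inj: "f s \<noteq> f s'" if "s \<in> S" "s' \<in> S" "s \<noteq> s'" for s s'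
  proof
    assume eq: "f s = f s'"
    have H: "F e \<in> C" using mult_left triD(2) carr by (auto simp: C_def)
    have "act s (F e) = F s" if s: "s \<in> S" for s
    proof
      show "act s (F e) \<subseteq> F s" using mult_right s by (auto simp: act_def)
      show "F s \<subseteq> act s (F e)"
      proof
        fix g assume g: "g \<in> F s"
        then have "g = g \<otimes> \<one>" using cl s by auto
        then show "g \<in> act s (F e)" using one g unfolding act_def by blast
      qed
    qed
    then have "F s = F s'" using fun_cong[OF eq, of "F e"] H that by (simp add: f_def)
    then show False using inj that by (auto dest: inj_onD)
  qed
  have "\<theta> \<circ> \<phi> \<in> hom K (sym_group (card C))"
    using \<phi>(1) \<theta>(1) by (auto simp: hom_def Pi_iff)
  moreover have "(\<theta> \<circ> \<phi>) (\<iota> s) \<noteq> (\<theta> \<circ> \<phi>) (\<iota> s')" if "s \<in> S" "s' \<in> S" "s \<noteq> s'" for s s'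
    using f_inj[OF that] \<theta>(2) f that \<phi>(2) by (auto dest: inj_onD)
  ultimately show ?thesis by blast
qed

lemma (in group) triangular_family_hom:
  assumes fin: "finite (carrier G)"
    and tri: "symmetric_triangular e sinv S R"
    and carr: "\<And>i s. i \<in> {1, 2, 3} \<Longrightarrow> s \<in> S \<Longrightarrow> F i s \<subseteq> carrier G"
    and ne: "\<And>i s. i \<in> {1, 2, 3} \<Longrightarrow> s \<in> S \<Longrightarrow> F i s \<noteq> {}"
    and one: "\<And>i. i \<in> {1, 2, 3} \<Longrightarrow> \<one> \<in> F i e"
    and rel: "\<And>i a b c x y. i \<in> {1, 2, 3} \<Longrightarrow> [c, b, a] \<in> R \<Longrightarrow> x \<in> F i a \<Longrightarrow> y \<in> F (nxt i) b \<Longrightarrow>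
      inv (y \<otimes> x) \<in> F (nxt (nxt i)) c"
    and disj: "\<And>s s'. s \<in> S \<Longrightarrow> s' \<in> S \<Longrightarrow> s \<noteq> s' \<Longrightarrow> F 1 s \<inter> F 1 s' = {}"
    and pres: "has_presentation K \<iota> S (insert [e] R)"
  shows "\<exists>(n :: nat) \<rho>. \<rho> \<in> hom K (sym_group n) \<and>
    (\<forall>s\<in>S. \<forall>s'\<in>S. s \<noteq> s' \<longrightarrow> \<rho> (\<iota> s) \<noteq> \<rho> (\<iota> s'))"
proof -
  note triD = symmetric_triangularD[OF tri]
  \<comment> \<open>With \<open>\<one>\<close> as middle factor, the relator
    \<open>[sinv s, e, s]\<close> lets inversion move to the preceding index.\<close>
  have inv_step: "inv x \<in> F (nxt (nxt i)) (sinv s)" if "i \<in> {1, 2, 3}" "s \<in> S" "x \<in> F i s" for i s x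
  proof -
    have "x \<in> carrier G" using carr that by blast
    moreover have "[sinv s, e, s] \<in> R" using triD(6,7) that(2) by blast
    ultimately show ?thesis
      using rel[OF that(1) _ that(3), of "sinv s" e \<one>] one nxt_closed[OF that(1)] by simp
  qed
  \<comment> \<open>Inverting twice shifts the index by four, hence by one modulo three.\<close>
  have rot: "x \<in> F (nxt i) s" if "i \<in> {1, 2, 3}" "s \<in> S" "x \<in> F i s" for i s x
  proof -
    have "x \<in> carrier G" using carr that by blast
    moreover have "nxt (nxt i) \<in> {1, 2, 3}" "nxt (nxt (nxt (nxt i))) = nxt i"
      using that(1) by auto
    ultimately show ?thesis
      using inv_step[OF _ triD(4)[OF that(2)] inv_step[OF that]] triD(5)[OF that(2)] by simp
  qed
  have F_eq: "F 1 s = F 2 s" "F 2 s = F 3 s" if "s \<in> S" for s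
    using rot[of 1 s] rot[of 2 s] rot[of 3 s] that by auto
  show ?thesis
  proof (rule coset_action[OF fin tri _ _ _ _ _ _ pres, of "F 1"])
    show "inv x \<in> F 1 (sinv s)" if "s \<in> S" "x \<in> F 1 s" for s x
      using inv_step[of 1 s x] that F_eq triD(4) by auto
    show "inv (y \<otimes> x) \<in> F 1 c" if "[c, b, a] \<in> R" "x \<in> F 1 a" "y \<in> F 1 b" for a b c x y
    proof -
      have "a \<in> S" "b \<in> S" "c \<in> S" using triD(9)[OF that(1)] by auto
      then show ?thesis using rel[of 1 c b a x y] that F_eq by auto
    qed
    show "inj_on (F 1) S"
      using disj ne[of 1] by (intro inj_onI) (metis inf.idem insertI1)
  qed (use carr[of 1] ne[of 1] one[of 1] in auto)
qed

section \<open>Permutations from collinear variables\<close>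

text \<open>The trace that independence of two discrete variables leaves on the support
  \<open>T\<close>; no probabilities occur in this section.\<close>

definition jointly_free :: "'t set \<Rightarrow> ('t \<Rightarrow> 'x) \<Rightarrow> ('t \<Rightarrow> 'y) \<Rightarrow> bool" where
  "jointly_free T f g \<longleftrightarrow> (\<forall>t\<in>T. \<forall>t'\<in>T. \<exists>t''\<in>T. f t'' = f t \<and> g t'' = g t')"

definition determine :: "'t set \<Rightarrow> ('t \<Rightarrow> 'x) \<Rightarrow> ('t \<Rightarrow> 'y) \<Rightarrow> ('t \<Rightarrow> 'z) \<Rightarrow> bool" where
  "determine T f g h \<longleftrightarrow> (\<forall>t\<in>T. \<forall>t'\<in>T. f t = f t' \<longrightarrow> g t = g t' \<longrightarrow> h t = h t')"

text \<open>The value triples form a possibly infinite Latin square with rows \<open>f\<close>,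
  columns \<open>g\<close> and symbols \<open>h\<close>.\<close>

definition latin_triple :: "'t set \<Rightarrow> ('t \<Rightarrow> 'x) \<Rightarrow> ('t \<Rightarrow> 'y) \<Rightarrow> ('t \<Rightarrow> 'z) \<Rightarrow> bool" where
  "latin_triple T f g h \<longleftrightarrow> jointly_free T f g \<and> jointly_free T f h \<and> jointly_free T g h \<and>
    determine T f g h \<and> determine T f h g \<and> determine T g h f"

lemma jointly_freeE:
  assumes "jointly_free T f g" "t \<in> T" "t' \<in> T"
  obtains t'' where "t'' \<in> T" "f t'' = f t" "g t'' = g t'"
  using assms unfolding jointly_free_def by blast

lemma determineD:
  "determine T f g h \<Longrightarrow> t \<in> T \<Longrightarrow> t' \<in> T \<Longrightarrow> f t = f t' \<Longrightarrow> g t = g t' \<Longrightarrow> h t = h t'"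
  unfolding determine_def by blast

lemma latin_tripleD:
  assumes "latin_triple T f g h"
  shows "jointly_free T f g" "jointly_free T f h" "jointly_free T g h"
    "determine T f g h" "determine T f h g" "determine T g h f"
  using assms by (auto simp: latin_triple_def)

lemma latin_triple_commute: "latin_triple T f g h \<Longrightarrow> latin_triple T g f h"
  unfolding latin_triple_def jointly_free_def determine_def by blast

lemma latin_triple_relabel:
  assumes "latin_triple T f g h" "inj_on \<phi> (f ` T)" "inj_on \<psi> (g ` T)"
  shows "latin_triple T (\<lambda>t. \<phi> (f t)) (\<lambda>t. \<psi> (g t)) h"
proof -
  note lat = latin_tripleD[OF assms(1)]
  have eq: "\<phi> (f t) = \<phi> (f t') \<longleftrightarrow> f t = f t'" "\<psi> (g t) = \<psi> (g t') \<longleftrightarrow> g t = g t'"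
    if "t \<in> T" "t' \<in> T" for t t'
    using assms(2,3) that by (auto dest: inj_onD)
  have "jointly_free T (\<lambda>t. \<phi> (f t)) (\<lambda>t. \<psi> (g t))"
    using lat(1) unfolding jointly_free_def by metis
  moreover have "jointly_free T (\<lambda>t. \<phi> (f t)) h" "jointly_free T (\<lambda>t. \<psi> (g t)) h"
    using lat(2,3) unfolding jointly_free_def by metis+
  moreover have "determine T (\<lambda>t. \<phi> (f t)) (\<lambda>t. \<psi> (g t)) h"
    using lat(4) eq unfolding determine_def by blast
  moreover have "determine T (\<lambda>t. \<phi> (f t)) h (\<lambda>t. \<psi> (g t))"
    using lat(5) eq unfolding determine_def by blast
  moreover have "determine T (\<lambda>t. \<psi> (g t)) h (\<lambda>t. \<phi> (f t))"
    using lat(6) eq unfolding determine_def by blast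
  ultimately show ?thesis by (simp add: latin_triple_def)
qed

text \<open>The cells of a Latin square that carry one fixed symbol form a permutation matrix, and
  \<open>p\<close> is its bijection from rows to columns. Extensionality is what later makes
  \<open>p\<close> an element of \<open>Bij\<close>.\<close>

lemma latin_triple_bij:
  assumes lat: "latin_triple T f g h" and t1: "t1 \<in> T"
  obtains p where "p \<in> extensional (f ` T)" "bij_betw p (f ` T) (g ` T)"
    "\<And>t. t \<in> T \<Longrightarrow> h t = h t1 \<longleftrightarrow> g t = p (f t)"
proof -
  note lat = latin_tripleD[OF lat]
  \<comment> \<open>The choice does not matter because \<open>f\<close> and \<open>h\<close>
    determine \<open>g\<close>.\<close>
  define p where "p = (\<lambda>x\<in>f ` T. g (SOME t. t \<in> T \<and> f t = x \<and> h t = h t1))"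
  have p: "h t = h t1 \<longleftrightarrow> g t = p (f t)" if t: "t \<in> T" for t
  proof -
    obtain t' where "t' \<in> T" "f t' = f t" "h t' = h t1"
      using lat(2) t t1 by (rule jointly_freeE)
    then have "\<exists>t'. t' \<in> T \<and> f t' = f t \<and> h t' = h t1" by blast
    from someI_ex[OF this] obtain t' where t': "t' \<in> T" "f t' = f t" "h t' = h t1" "p (f t) = g t'"
      using t unfolding p_def by auto
    show ?thesis
      using determineD[OF lat(5) t t'(1)] determineD[OF lat(4) t t'(1)] t' by auto
  qed
  have "bij_betw p (f ` T) (g ` T)"
  proof (rule bij_betw_imageI)
    have *: "\<exists>t'\<in>T. f t' = f t \<and> h t' = h t1 \<and> g t' = p (f t)" if "t \<in> T" for t
      using jointly_freeE[OF lat(2) that t1] p by metis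
    show "inj_on p (f ` T)"
    proof (rule inj_onI, clarify)
      fix s t assume st: "s \<in> T" "t \<in> T" "p (f s) = p (f t)"
      obtain s' where s': "s' \<in> T" "f s' = f s" "h s' = h t1" "g s' = p (f s)"
        using *[OF st(1)] by blast
      obtain t' where t': "t' \<in> T" "f t' = f t" "h t' = h t1" "g t' = p (f t)"
        using *[OF st(2)] by blast
      show "f s = f t"
        using determineD[OF lat(6) s'(1) t'(1)] s' t' st(3) by simp
    qed
    show "p ` f ` T = g ` T"
    proof
      show "p ` f ` T \<subseteq> g ` T"
      proof clarify
        fix t assume "t \<in> T"
        then show "p (f t) \<in> g ` T" using *[of t] by (metis imageI)
      qed
      show "g ` T \<subseteq> p ` f ` T"
      proof clarify
        fix t assume "t \<in> T"
        then obtain t' where "t' \<in> T" "g t' = g t" "h t' = h t1"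
          using lat(3) t1 by (metis jointly_freeE)
        then show "g t \<in> p ` f ` T" using p by (metis imageI)
      qed
    qed
  qed
  moreover have "p \<in> extensional (f ` T)" by (simp add: p_def)
  ultimately show thesis using that p by blast
qed

text \<open>
  \<open>b i\<close> and \<open>c s i\<close> are the values of \<open>b\<^sub>i\<close> and \<open>s\<^sub>i\<close> at an outcome. Fixing the value
  of \<open>s\<^sub>i\<close> turns the value of \<open>b\<^sub>i\<close> into that of \<open>b\<^bsub>i+1\<^esub>\<close> by a permutation, and along a line
  \<open>{s\<^sub>i, s'\<^sub>j, s''\<^sub>k}\<close> the three permutations compose to the identity. The sets of permutations
  arising from all values of \<open>s\<^sub>i\<close> are the cosets representing \<open>s\<close>.
\<close>

lemma aligned_configuration_hom:
  fixes b :: "nat \<Rightarrow> 't \<Rightarrow> 'v" and c :: "'s \<Rightarrow> nat \<Rightarrow> 't \<Rightarrow> 'v"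
  assumes tri: "symmetric_triangular e sinv S R"
    and pres: "has_presentation G \<iota> S (insert [e] R)"
    and V: "\<And>i. i \<in> {1, 2, 3} \<Longrightarrow> b i ` T = V" and fin: "finite V"
    and two: "v \<in> V" "v' \<in> V" "v \<noteq> v'"
    and latin: "\<And>i s. i \<in> {1, 2, 3} \<Longrightarrow> s \<in> S \<Longrightarrow> latin_triple T (b i) (b (nxt i)) (c s i)"
    and free: "\<And>i x y z. i \<in> {1, 2, 3} \<Longrightarrow> x \<in> V \<Longrightarrow> y \<in> V \<Longrightarrow> z \<in> V \<Longrightarrow>
      \<exists>t\<in>T. b i t = x \<and> b (nxt i) t = y \<and> b (nxt (nxt i)) t = z"
    and rel_free: "\<And>i s s' s''. i \<in> {1, 2, 3} \<Longrightarrow> [s'', s', s] \<in> R \<Longrightarrow>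
      jointly_free T (c s i) (c s' (nxt i))"
    and rel_det: "\<And>i s s' s''. i \<in> {1, 2, 3} \<Longrightarrow> [s'', s', s] \<in> R \<Longrightarrow>
      determine T (c s i) (c s' (nxt i)) (c s'' (nxt (nxt i)))"
    and dist: "\<And>s s'. s \<in> S \<Longrightarrow> s' \<in> S \<Longrightarrow> s \<noteq> s' \<Longrightarrow> determine T (c s 1) (c s' 1) (b 1)"
    and t0: "t0 \<in> T"
    and aligned: "\<And>i t. i \<in> {1, 2, 3} \<Longrightarrow> t \<in> T \<Longrightarrow> c e i t = c e i t0 \<Longrightarrow> b (nxt i) t = b i t"
  shows "\<exists>(n :: nat) \<rho>. \<rho> \<in> hom G (sym_group n) \<and>
    (\<forall>s\<in>S. \<forall>s'\<in>S. s \<noteq> s' \<longrightarrow> \<rho> (\<iota> s) \<noteq> \<rho> (\<iota> s'))"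
proof -
  note triD = symmetric_triangularD[OF tri]
  \<comment> \<open>The outcome \<open>t1\<close> stands for the value of \<open>c s i\<close> at
    it; \<open>p\<close> is the permutation cut out by that value.\<close>
  define graph where "graph i s t1 p \<longleftrightarrow>
    p \<in> Bij V \<and> (\<forall>t\<in>T. c s i t = c s i t1 \<longleftrightarrow> b (nxt i) t = p (b i t))" for i s t1 p
  define F where "F i s = {p. \<exists>t1\<in>T. graph i s t1 p}" for i s
  have ex: "\<exists>p. graph i s t1 p" if i: "i \<in> {1, 2, 3}" and "s \<in> S" "t1 \<in> T" for i s t1
  proof -
    obtain p where "p \<in> extensional (b i ` T)" "bij_betw p (b i ` T) (b (nxt i) ` T)"
        "\<And>t. t \<in> T \<Longrightarrow> c s i t = c s i t1 \<longleftrightarrow> b (nxt i) t = p (b i t)"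
      using latin_triple_bij[OF latin[OF i \<open>s \<in> S\<close>] \<open>t1 \<in> T\<close>] by blast
    then show ?thesis unfolding graph_def using V[OF i] V[OF nxt_closed[OF i]]
      by (auto simp: Bij_def)
  qed
  have bV: "b i t \<in> V" if "i \<in> {1, 2, 3}" "t \<in> T" for i t
    using V[OF that(1)] that(2) by blast
  have BijV: "p x \<in> V" if "p \<in> Bij V" "x \<in> V" for p x
    using that by (auto simp: Bij_def dest: bij_betwE)
  interpret K: group "BijGroup V" by (rule group_BijGroup)
  show ?thesis
  proof (rule K.triangular_family_hom[where F = F, OF _ tri _ _ _ _ _ pres])
    show "finite (carrier (BijGroup V))" using finite_Bij[OF fin] by (simp add: BijGroup_simps)
    show "F i s \<subseteq> carrier (BijGroup V)" for i s by (auto simp: F_def graph_def BijGroup_simps)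
    show "F i s \<noteq> {}" if "i \<in> {1, 2, 3}" "s \<in> S" for i s
      using ex[OF that t0] t0 by (auto simp: F_def)
  next
    fix i :: nat assume i: "i \<in> {1, 2, 3}"
    obtain p where p: "graph i e t0 p" using ex[OF i triD(2) t0] by blast
    \<comment> \<open>Every point \<open>(x, p x)\<close> of the graph is realized by an outcome,
      where alignment forces \<open>p x = x\<close>.\<close>
    have "p = (\<lambda>x\<in>V. x)"
    proof (rule extensionalityI[of _ V])
      fix x assume x: "x \<in> V"
      then obtain t where t: "t \<in> T" "b i t = x" "b (nxt i) t = p x"
        using free[OF i x BijV x, of p] p unfolding graph_def by blast
      then have "c e i t = c e i t0" using p unfolding graph_def by simp
      then show "p x = (\<lambda>x\<in>V. x) x" using aligned[OF i t(1)] t x by simp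
    qed (use p in \<open>auto simp: graph_def Bij_def\<close>)
    then show "\<one>\<^bsub>BijGroup V\<^esub> \<in> F i e" using p t0 by (auto simp: F_def BijGroup_simps)
  next
    fix i s s' s'' p q
    assume i: "i \<in> {1, 2, 3}" and R: "[s'', s', s] \<in> R" and "p \<in> F i s" "q \<in> F (nxt i) s'"
    then obtain t1 t2 where t1: "t1 \<in> T" "graph i s t1 p" and t2: "t2 \<in> T" "graph (nxt i) s' t2 q"
      by (auto simp: F_def)
    have S: "s'' \<in> S" using triD(9)[OF R] by simp
    note i' = nxt_closed[OF i] nxt_closed[OF nxt_closed[OF i]]
    have cyc: "nxt (nxt (nxt i)) = i" using i by auto
    \<comment> \<open>One outcome shows the values behind both \<open>p\<close> and
      \<open>q\<close>; its value of the third copy supplies \<open>r\<close>.\<close>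
    obtain t where t: "t \<in> T" "c s i t = c s i t1" "c s' (nxt i) t = c s' (nxt i) t2"
      using rel_free[OF i R] t1(1) t2(1) by (rule jointly_freeE)
    obtain r where r: "graph (nxt (nxt i)) s'' t r" using ex[OF i'(2) S t(1)] by blast
    have B: "p \<in> Bij V" "q \<in> Bij V" "r \<in> Bij V"
      using t1 t2 r by (auto simp: graph_def)
    \<comment> \<open>An outcome whose bases take the values \<open>x\<close>, \<open>p x\<close>,
      \<open>q (p x)\<close> agrees with \<open>t\<close> on the first two copies, hence on the
      third, so \<open>r\<close> leads back to \<open>x\<close>.\<close>
    have "r (q (p x)) = x" if x: "x \<in> V" for x
    proof -
      obtain t' where t': "t' \<in> T" "b i t' = x" "b (nxt i) t' = p x" "b (nxt (nxt i)) t' = q (p x)"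
        using free[OF i x BijV[OF B(1) x] BijV[OF B(2) BijV[OF B(1) x]]] by blast
      then have "c s i t' = c s i t1" "c s' (nxt i) t' = c s' (nxt i) t2"
        using t1(2) t2(2) by (simp_all add: graph_def)
      then have "c s i t' = c s i t" "c s' (nxt i) t' = c s' (nxt i) t"
        using t by simp_all
      then have "c s'' (nxt (nxt i)) t' = c s'' (nxt (nxt i)) t"
        using determineD[OF rel_det[OF i R]] t(1) t'(1) by blast
      then show ?thesis using r t' by (auto simp: graph_def cyc)
    qed
    then have "r \<otimes>\<^bsub>BijGroup V\<^esub> (q \<otimes>\<^bsub>BijGroup V\<^esub> p) = \<one>\<^bsub>BijGroup V\<^esub>"
      using B by (simp add: BijGroup_simps compose_Bij) (auto simp: compose_def BijV)
    then have "inv\<^bsub>BijGroup V\<^esub> (q \<otimes>\<^bsub>BijGroup V\<^esub> p) = r"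
      using B by (intro K.inv_equality) (auto simp: BijGroup_simps compose_Bij)
    then show "inv\<^bsub>BijGroup V\<^esub> (q \<otimes>\<^bsub>BijGroup V\<^esub> p) \<in> F (nxt (nxt i)) s''"
      using r t(1) by (auto simp: F_def)
  next
    fix s s' assume s: "s \<in> S" "s' \<in> S" "s \<noteq> s'"
    show "F 1 s \<inter> F 1 s' = {}"
    proof (rule ccontr)
      assume "F 1 s \<inter> F 1 s' \<noteq> {}"
      \<comment> \<open>A common \<open>p\<close> lets both copies keep their values while
        \<open>b 1\<close> takes the values \<open>v\<close> and \<open>v'\<close>, although the two
        copies determine \<open>b 1\<close>.\<close>
      then obtain p t1 t2 where p: "t1 \<in> T" "graph 1 s t1 p" "t2 \<in> T" "graph 1 s' t2 p"
        by (auto simp: F_def)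
      then have B: "p \<in> Bij V" by (simp add: graph_def)
      obtain t where t: "t \<in> T" "b 1 t = v" "b (nxt 1) t = p v"
        using free[of 1 v "p v" v] two BijV[OF B] by auto
      obtain t' where t': "t' \<in> T" "b 1 t' = v'" "b (nxt 1) t' = p v'"
        using free[of 1 v' "p v'" v'] two BijV[OF B] by auto
      have "c s 1 t = c s 1 t1" "c s' 1 t = c s' 1 t2" "c s 1 t' = c s 1 t1" "c s' 1 t' = c s' 1 t2"
        using t t' p(2,4) by (simp_all add: graph_def)
      then show False using determineD[OF dist[OF s] t(1) t'(1)] t t' two(3) by simp
    qed
  qed
qed

text \<open>The values of the second and third base are relabelled by those of the first, through
  the values of \<open>e_1\<close> and \<open>e_3\<close> at one outcome. This turns two of the
  three permutations for \<open>e\<close> into the identity, and the relator \<open>eee\<close> does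
  the same for the third.\<close>

lemma configuration_hom:
  fixes b :: "nat \<Rightarrow> 't \<Rightarrow> 'v" and c :: "'s \<Rightarrow> nat \<Rightarrow> 't \<Rightarrow> 'v"
  assumes tri: "symmetric_triangular e sinv S R"
    and pres: "has_presentation G \<iota> S (insert [e] R)"
    and fin: "finite (b 1 ` T)"
    and two: "t \<in> T" "t' \<in> T" "b 1 t \<noteq> b 1 t'"
    and latin: "\<And>i s. i \<in> {1, 2, 3} \<Longrightarrow> s \<in> S \<Longrightarrow> latin_triple T (b i) (b (nxt i)) (c s i)"
    and free: "\<And>t1 t2 t3. t1 \<in> T \<Longrightarrow> t2 \<in> T \<Longrightarrow> t3 \<in> T \<Longrightarrow>
      \<exists>t\<in>T. b 1 t = b 1 t1 \<and> b 2 t = b 2 t2 \<and> b 3 t = b 3 t3"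
    and rel_free: "\<And>i s s' s''. i \<in> {1, 2, 3} \<Longrightarrow> [s'', s', s] \<in> R \<Longrightarrow>
      jointly_free T (c s i) (c s' (nxt i))"
    and rel_det: "\<And>i s s' s''. i \<in> {1, 2, 3} \<Longrightarrow> [s'', s', s] \<in> R \<Longrightarrow>
      determine T (c s i) (c s' (nxt i)) (c s'' (nxt (nxt i)))"
    and dist: "\<And>s s'. s \<in> S \<Longrightarrow> s' \<in> S \<Longrightarrow> s \<noteq> s' \<Longrightarrow> determine T (c s 1) (c s' 1) (b 1)"
  shows "\<exists>(n :: nat) \<rho>. \<rho> \<in> hom G (sym_group n) \<and>
    (\<forall>s\<in>S. \<forall>s'\<in>S. s \<noteq> s' \<longrightarrow> \<rho> (\<iota> s) \<noteq> \<rho> (\<iota> s'))"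
proof -
  note triD = symmetric_triangularD[OF tri]
  define t0 where "t0 = t"
  have t0: "t0 \<in> T" using two by (simp add: t0_def)
  have eee: "[e, e, e] \<in> R" using triD(6)[OF triD(2)] triD(3) by simp
  have l1: "latin_triple T (b 2) (b 1) (c e 1)" and l2: "latin_triple T (b 2) (b 3) (c e 2)"
    and l3: "latin_triple T (b 3) (b 1) (c e 3)"
    using latin[of 1 e] latin[of 2 e] latin[of 3 e] triD(2) by (auto intro: latin_triple_commute)
  obtain \<phi>2 where \<phi>2: "bij_betw \<phi>2 (b 2 ` T) (b 1 ` T)"
      "\<And>t. t \<in> T \<Longrightarrow> c e 1 t = c e 1 t0 \<longleftrightarrow> b 1 t = \<phi>2 (b 2 t)"
    using latin_triple_bij[OF l1 t0] by metis
  obtain \<phi>3 where \<phi>3: "bij_betw \<phi>3 (b 3 ` T) (b 1 ` T)"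
      "\<And>t. t \<in> T \<Longrightarrow> c e 3 t = c e 3 t0 \<longleftrightarrow> b 1 t = \<phi>3 (b 3 t)"
    using latin_triple_bij[OF l3 t0] by metis
  define \<phi> where "\<phi> i = (if i = 2 then \<phi>2 else if i = 3 then \<phi>3 else id)" for i :: nat
  have \<phi>: "bij_betw (\<phi> i) (b i ` T) (b 1 ` T)" if "i \<in> {1, 2, 3}" for i
    using that \<phi>2(1) \<phi>3(1) by (auto simp: \<phi>_def)
  define b' where "b' i t = \<phi> i (b i t)" for i t
  have b'V: "b' i ` T = b 1 ` T" if "i \<in> {1, 2, 3}" for i
    using bij_betw_imp_surj_on[OF \<phi>[OF that]] by (simp add: b'_def image_image)
  have free': "\<exists>t\<in>T. b' 1 t = x \<and> b' 2 t = y \<and> b' 3 t = z"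
    if xyz: "x \<in> b 1 ` T" "y \<in> b 1 ` T" "z \<in> b 1 ` T" for x y z
  proof -
    have "x \<in> b' 1 ` T" "y \<in> b' 2 ` T" "z \<in> b' 3 ` T" using xyz b'V by auto
    then obtain t1 t2 t3 where "t1 \<in> T" "t2 \<in> T" "t3 \<in> T" "x = b' 1 t1" "y = b' 2 t2" "z = b' 3 t3"
      by blast
    then show ?thesis using free[of t1 t2 t3] unfolding b'_def by metis
  qed
  show ?thesis
  proof (rule aligned_configuration_hom[where b = b' and c = c and T = T,
        OF tri pres b'V fin _ _ _ _ _ rel_free rel_det _ t0])
    show "b 1 t \<in> b 1 ` T" "b 1 t' \<in> b 1 ` T" "b 1 t \<noteq> b 1 t'" using two by auto
    show "latin_triple T (b' i) (b' (nxt i)) (c s i)" if "i \<in> {1, 2, 3}" "s \<in> S" for i s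
      unfolding b'_def
      by (rule latin_triple_relabel[OF latin[OF that] \<phi>[OF that(1), THEN bij_betw_imp_inj_on]
            \<phi>[OF nxt_closed[OF that(1)], THEN bij_betw_imp_inj_on]])
    show "\<exists>t\<in>T. b' i t = x \<and> b' (nxt i) t = y \<and> b' (nxt (nxt i)) t = z"
      if "i \<in> {1, 2, 3}" "x \<in> b 1 ` T" "y \<in> b 1 ` T" "z \<in> b 1 ` T" for i x y z
      using that(1) free'[of x y z] free'[of z x y] free'[of y z x] that(2-4) by auto
    show "determine T (c s 1) (c s' 1) (b' 1)" if "s \<in> S" "s' \<in> S" "s \<noteq> s'" for s s'
    proof -
      have "b' 1 = b 1" by (simp add: fun_eq_iff b'_def \<phi>_def)
      then show ?thesis using dist[OF that] by simp
    qed
  next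
    fix i u assume i: "i \<in> {1, 2, 3}" and u: "u \<in> T" "c e i u = c e i t0"
    \<comment> \<open>The outcome \<open>w\<close> keeps bases 2 and 3 of \<open>u\<close> and gives
      base 1 the label of base 2. Then \<open>e_1\<close> and \<open>e_2\<close> have their values
      at \<open>t0\<close>, so by \<open>eee\<close> does \<open>e_3\<close>, and the labels of
      bases 1 and 3 agree.\<close>
    have "b' 3 u = b' 2 u" if "c e 2 u = c e 2 t0"
    proof -
      have "b' 2 u \<in> b 1 ` T" "b' 3 u \<in> b 1 ` T"
        using b'V[of 2] b'V[of 3] u(1) by blast+
      then obtain w where w: "w \<in> T" "b' 1 w = b' 2 u" "b' 2 w = b' 2 u" "b' 3 w = b' 3 u"
        using free'[of "b' 2 u" "b' 2 u" "b' 3 u"] by blast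
      then have "b 2 w = b 2 u" "b 3 w = b 3 u"
        using \<phi>[of 2] \<phi>[of 3] u(1) by (auto simp: b'_def bij_betw_def dest: inj_onD)
      then have "c e 2 w = c e 2 t0"
        using determineD[OF latin_tripleD(4)[OF l2] w(1) u(1)] that by simp
      moreover have "c e 1 w = c e 1 t0"
        using \<phi>2(2)[OF w(1)] w by (simp add: b'_def \<phi>_def)
      ultimately have "c e 3 w = c e 3 t0"
        using determineD[OF rel_det[OF _ eee, of 1] w(1) t0] by simp
      then have "b' 1 w = b' 3 w" using \<phi>3(2)[OF w(1)] by (simp add: b'_def \<phi>_def)
      then show ?thesis using w by simp
    qed
    then show "b' (nxt i) u = b' i u"
      using i u \<phi>2(2)[OF u(1)] \<phi>3(2)[OF u(1)] by (auto simp: b'_def \<phi>_def)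
  qed auto
qed

section \<open>Supports of entropic matroids\<close>

text \<open>The equality case of Gibbs' inequality. With \<open>r\<close> the ratio
  \<open>q / p\<close>, the function \<open>r - 1 - ln r\<close> is nonnegative with mean
  \<open>measure q (set_pmf p) - 1\<close>, which is at most zero, so \<open>r = 1\<close> on the
  support of \<open>p\<close>. The inclusion of supports keeps \<open>r\<close> positive
  there.\<close>

lemma pmf_eq_if_relative_entropy_zero:
  fixes p q :: "'a pmf"
  assumes sub: "set_pmf p \<subseteq> set_pmf q"
    and int: "integrable (measure_pmf p) (\<lambda>x. ln (pmf q x / pmf p x))"
    and zero: "(\<integral>x. ln (pmf q x / pmf p x) \<partial>measure_pmf p) = 0"
  shows "p = q"
proof -
  let ?r = "\<lambda>x. pmf q x / pmf p x"
  have r: "pmf p x *\<^sub>R ?r x = indicator (set_pmf p) x *\<^sub>R pmf q x" for x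
    by (auto simp: indicator_def set_pmf_eq)
  have int_q: "integrable (count_space UNIV) (\<lambda>x. indicator (set_pmf p) x *\<^sub>R pmf q x)"
    using integrable_pmf[of "set_pmf p" q] restrict_count_space[of UNIV "set_pmf p"]
      integrable_restrict_space[of "set_pmf p" "count_space UNIV" "pmf q"] by simp
  then have int_r: "integrable (measure_pmf p) ?r"
    unfolding measure_pmf_eq_density[of p] by (subst integrable_density) (simp_all only: r, simp_all)
  \<comment> \<open>The mean of the ratio is the \<open>q\<close>-mass of the support of
    \<open>p\<close>, not yet known to be one.\<close>
  have "(\<integral>x. ?r x \<partial>measure_pmf p) = (\<integral>x. indicator (set_pmf p) x *\<^sub>R pmf q x \<partial>count_space UNIV)"
    unfolding measure_pmf_eq_density[of p] by (subst integral_density) (simp_all only: r, simp_all)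
  also have "\<dots> = measure q (set_pmf p)"
    using integral_pmf[of "set_pmf p" q] restrict_count_space[of UNIV "set_pmf p"]
      integral_restrict_space[of "set_pmf p" "count_space UNIV" "pmf q"] by simp
  finally have int_r_eq: "(\<integral>x. ?r x \<partial>measure_pmf p) = measure q (set_pmf p)" .
  have pos: "?r x > 0" if "x \<in> set_pmf p" for x
    using that sub by (auto simp: pmf_positive)
  let ?k = "\<lambda>x. ?r x - 1 - ln (?r x)"
  have int_k: "integrable (measure_pmf p) ?k"
    using int int_r by simp
  have nn: "AE x in measure_pmf p. 0 \<le> ?k x"
    using ln_le_minus_one[OF pos] by (auto simp: AE_measure_pmf_iff)
  have "(\<integral>x. ?k x \<partial>measure_pmf p) = measure q (set_pmf p) - 1"
    using int int_r zero int_r_eq by simp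
  then have "(\<integral>x. ?k x \<partial>measure_pmf p) = 0"
    using integral_nonneg_AE[OF nn] measure_pmf.prob_le_1[of q "set_pmf p"] by simp
  then have "AE x in measure_pmf p. ?k x = 0"
    using integral_nonneg_eq_0_iff_AE[OF int_k nn] by simp
  then have "\<forall>x\<in>set_pmf p. ln (?r x) = ?r x - 1"
    by (simp add: AE_measure_pmf_iff)
  then have "?r x = 1" if "x \<in> set_pmf p" for x
    using ln_eq_minus_one[OF pos[OF that]] that by blast
  then have eq: "pmf q x = pmf p x" if "x \<in> set_pmf p" for x
    using that pmf_positive[OF that] by (auto simp: field_simps)
  \<comment> \<open>Since the masses agree on the support of \<open>p\<close>, that set has full
    \<open>q\<close>-mass and \<open>q\<close> has no other atoms.\<close>
  have "measure q (set_pmf p) = measure p (set_pmf p)"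
    unfolding integral_pmf[symmetric] by (rule Bochner_Integration.integral_cong) (auto simp: eq)
  also have "\<dots> = 1"
    by (simp add: measure_pmf.prob_eq_1 AE_measure_pmf)
  finally have "AE x in measure_pmf q. x \<in> set_pmf p"
    by (simp add: measure_pmf.prob_eq_1)
  then have "set_pmf q \<subseteq> set_pmf p"
    by (auto simp: AE_measure_pmf_iff)
  then show ?thesis
    using eq by (intro pmf_eqI) (metis pmf_eq_0_set_pmf subsetD)
qed

text \<open>Sufficiently many atoms of the same positive mass would exceed total mass one.\<close>

lemma finite_set_pmf_const:
  assumes "\<And>x. x \<in> set_pmf p \<Longrightarrow> pmf p x = k"
  shows "finite (set_pmf p)"
proof (rule ccontr)
  assume inf: "infinite (set_pmf p)"
  obtain x where "x \<in> set_pmf p" using set_pmf_not_empty by fast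
  then have k: "k > 0" using assms pmf_positive by metis
  obtain n :: nat where n: "1 / k < real n" using reals_Archimedean2 by blast
  obtain A where A: "finite A" "card A = n" "A \<subseteq> set_pmf p"
    using infinite_arbitrarily_large[OF inf] by blast
  have "measure p A = (\<Sum>x\<in>A. pmf p x)" using A by (simp add: measure_measure_pmf_finite)
  also have "\<dots> = (\<Sum>x\<in>A. k)" using A assms by (intro sum.cong) auto
  also have "\<dots> = real n * k" using A by simp
  finally have "real n * k \<le> 1" using measure_pmf.prob_le_1[of p A] by simp
  then show False using n k by (simp add: field_simps)
qed

text \<open>
  The events \<open>(f, g) = (f t, g t)\<close> and \<open>(f, h) = (f t, h t)\<close> agree almost surely, so independence gives
  \<open>P(g = g t) = P(h = h t)\<close>. As \<open>g\<close> and \<open>h\<close> take every pair of values, both are uniform.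
\<close>

lemma finite_values_if_latin:
  assumes fg: "map_pmf (\<lambda>t. (f t, g t)) D = pair_pmf (map_pmf f D) (map_pmf g D)"
    and fh: "map_pmf (\<lambda>t. (f t, h t)) D = pair_pmf (map_pmf f D) (map_pmf h D)"
    and gh: "map_pmf (\<lambda>t. (g t, h t)) D = pair_pmf (map_pmf g D) (map_pmf h D)"
    and det_h: "\<And>t t'. t \<in> set_pmf D \<Longrightarrow> t' \<in> set_pmf D \<Longrightarrow> f t = f t' \<Longrightarrow> g t = g t' \<Longrightarrow> h t = h t'"
    and det_g: "\<And>t t'. t \<in> set_pmf D \<Longrightarrow> t' \<in> set_pmf D \<Longrightarrow> f t = f t' \<Longrightarrow> h t = h t' \<Longrightarrow> g t = g t'"
  shows "finite (g ` set_pmf D)"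
proof -
  have eq: "pmf (map_pmf g D) (g t) = pmf (map_pmf h D) (h t)" if t: "t \<in> set_pmf D" for t
  proof -
    have "pmf (map_pmf (\<lambda>t. (f t, g t)) D) (f t, g t) = pmf (map_pmf (\<lambda>t. (f t, h t)) D) (f t, h t)"
      unfolding pmf_map
      by (rule measure_pmf.finite_measure_eq_AE)
        (use det_h[OF _ t] det_g[OF _ t] in \<open>auto simp: AE_measure_pmf_iff\<close>)
    moreover have "pmf (map_pmf f D) (f t) > 0"
      using t by (intro pmf_positive) simp
    ultimately show ?thesis unfolding fg fh pmf_pair by simp
  qed
  obtain t0 where t0: "t0 \<in> set_pmf D" using set_pmf_not_empty by fast
  have "pmf (map_pmf g D) x = pmf (map_pmf h D) (h t0)" if "x \<in> set_pmf (map_pmf g D)" for x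
  proof -
    have "(x, h t0) \<in> set_pmf (map_pmf (\<lambda>t. (g t, h t)) D)"
      unfolding gh using that t0 by simp
    then obtain t where "t \<in> set_pmf D" "x = g t" "h t0 = h t" by auto
    then show ?thesis using eq by simp
  qed
  then have "finite (set_pmf (map_pmf g D))" by (rule finite_set_pmf_const)
  then show ?thesis by simp
qed

section \<open>Marginal laws and their entropies\<close>

abbreviation marginal :: "('a \<Rightarrow> 'v) pmf \<Rightarrow> 'a set \<Rightarrow> ('a \<Rightarrow> 'v) pmf" where
  "marginal D A \<equiv> map_pmf (\<lambda>t. restrict t A) D"

lemma restrict_eq_iff: "restrict f A = restrict g A \<longleftrightarrow> (\<forall>x\<in>A. f x = g x)"
  by (metis restrict_apply' restrict_ext)

text \<open>The values of mass zero in the countable range form a null set, so almost every value is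
  an atom, as the type \<open>pmf\<close> demands.\<close>

lemma pmf_of_discrete_random_variable:
  assumes "prob_space P" and Y: "Y \<in> P \<rightarrow>\<^sub>M count_space UNIV" and count: "countable (Y ` space P)"
  obtains D where "measure_pmf D = distr P (count_space UNIV) Y"
proof -
  interpret prob_space P by fact
  let ?M = "distr P (count_space UNIV) Y"
  interpret M: prob_space ?M using Y by (rule prob_space_distr)
  have "AE x in ?M. x \<in> Y ` space P"
    using Y by (simp add: AE_distr_iff)
  then have "AE x in ?M. measure ?M {x} \<noteq> 0"
  proof -
    let ?N = "{x \<in> Y ` space P. measure ?M {x} = 0}"
    have "?N \<in> null_sets ?M"
    proof -
      have "countable ?N" using count by (rule countable_subset[rotated]) auto
      moreover have "{x} \<in> null_sets ?M" if "x \<in> ?N" for x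
        using that by (auto simp: null_sets_def M.emeasure_eq_measure)
      ultimately have "(\<Union>x\<in>?N. {x}) \<in> null_sets ?M" by (intro null_sets_UN') auto
      then show ?thesis by simp
    qed
    then have "AE x in ?M. x \<notin> ?N" by (rule AE_not_in)
    with \<open>AE x in ?M. x \<in> Y ` space P\<close> show ?thesis by eventually_elim auto
  qed
  then have "measure_pmf (Abs_pmf ?M) = ?M"
    by (intro Abs_pmf_inverse) (auto simp: M.prob_space_axioms)
  then show thesis by (rule that)
qed

text \<open>The density with respect to counting measure is the mass function, as singletons show,
  and the entropy is the mean of its negative logarithm. The factor \<open>ln 2\<close> converts
  from base 2; integrability excludes the default value of a divergent integral.\<close>

lemma has_shannon_entropy_pmf:
  fixes Y :: "'w \<Rightarrow> 'v"
  assumes "prob_space P" and D: "measure_pmf D = distr P (count_space UNIV) Y"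
    and Y: "Y \<in> P \<rightarrow>\<^sub>M count_space UNIV"
    and ent: "has_shannon_entropy P Y h"
  shows "integrable (measure_pmf D) (\<lambda>y. ln (pmf D y))"
    and "ln 2 * h = - (\<integral>y. ln (pmf D y) \<partial>measure_pmf D)"
proof -
  interpret prob_space P by fact
  interpret information_space P 2 by unfold_locales simp
  let ?S = "count_space (Y ` space P)"
  obtain f where f: "finite_entropy ?S Y f"
    using ent unfolding has_shannon_entropy_def by blast
  have dist: "distributed P ?S Y f" and int: "integrable ?S (\<lambda>x. f x * log 2 (f x))"
    and nn: "\<And>x. x \<in> Y ` space P \<Longrightarrow> 0 \<le> f x"
    using f by (auto simp: finite_entropy_def)
  have YS: "Y \<in> P \<rightarrow>\<^sub>M ?S" and distr: "distr P ?S Y = density ?S f"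
    using dist by (auto simp: distributed_def)
  have f_eq: "f y = pmf D y" if y: "y \<in> Y ` space P" for y
  proof -
    have "ennreal (f y) = emeasure (density ?S f) {y}"
      using y by (simp add: emeasure_density nn_integral_count_space_indicator)
    also have "\<dots> = emeasure (distr P (count_space UNIV) Y) {y}"
      unfolding distr[symmetric] using y YS Y by (simp add: emeasure_distr)
    also have "\<dots> = ennreal (pmf D y)"
      unfolding D[symmetric] by (simp add: emeasure_pmf_single)
    finally show ?thesis using nn[OF y] by simp
  qed
  have D_int: "integrable (measure_pmf D) g \<longleftrightarrow> integrable P (\<lambda>x. g (Y x))"
    "(\<integral>y. g y \<partial>measure_pmf D) = (\<integral>x. g (Y x) \<partial>P)" for g :: "'v \<Rightarrow> real"
    unfolding D using Y by (auto simp: integrable_distr_eq integral_distr)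
  have log_eq: "ln (pmf D (Y x)) = ln 2 * log 2 (f (Y x))" if "x \<in> space P" for x
    using that by (simp add: f_eq log_def)
  have "integrable (density ?S f) (\<lambda>x. log 2 (f x))"
    using int nn by (subst integrable_density) (auto intro!: AE_I2)
  then have "integrable P (\<lambda>x. log 2 (f (Y x)))"
    unfolding distr[symmetric] using YS by (subst (asm) integrable_distr_eq) auto
  then have "integrable P (\<lambda>x. ln 2 * log 2 (f (Y x)))" by simp
  then show "integrable (measure_pmf D) (\<lambda>y. ln (pmf D y))"
    unfolding D_int by (subst Bochner_Integration.integrable_cong[OF HOL.refl log_eq]) auto
  have "h = - (\<integral>x. f x * log 2 (f x) \<partial>?S)"
    using entropy_distr[OF dist] nn ent unfolding has_shannon_entropy_def by simp
  also have "(\<integral>x. f x * log 2 (f x) \<partial>?S) = (\<integral>x. log 2 (f x) \<partial>density ?S f)"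
    using nn by (subst integral_density) (auto intro!: AE_I2)
  also have "\<dots> = (\<integral>x. log 2 (f (Y x)) \<partial>P)"
    unfolding distr[symmetric] using YS by (subst integral_distr) auto
  finally have "ln 2 * h = - (\<integral>x. ln 2 * log 2 (f (Y x)) \<partial>P)" by simp
  also have "(\<integral>x. ln 2 * log 2 (f (Y x)) \<partial>P) = (\<integral>x. ln (pmf D (Y x)) \<partial>P)"
    by (rule Bochner_Integration.integral_cong) (auto simp: log_eq)
  finally show "ln 2 * h = - (\<integral>y. ln (pmf D y) \<partial>measure_pmf D)"
    unfolding D_int .
qed

text \<open>All entropies become means under one law \<open>D\<close>, that of the joint variable on
  \<open>E\<close>, so entropies of different subsets can be compared outcome by outcome.\<close>

lemma entropic_pmf:
  assumes "entropic TYPE('w) TYPE('v) E r"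
  obtains D :: "('a \<Rightarrow> 'v) pmf" and c :: real where "c > 0"
    "\<And>A. A \<subseteq> E \<Longrightarrow> integrable (measure_pmf D) (\<lambda>t. ln (pmf (marginal D A) (restrict t A)))"
    "\<And>A. A \<subseteq> E \<Longrightarrow>
      real (r A) = - c * (\<integral>t. ln (pmf (marginal D A) (restrict t A)) \<partial>measure_pmf D)"
proof -
  obtain P :: "'w measure" and X :: "'a \<Rightarrow> 'w \<Rightarrow> 'v" and c where
    P: "prob_space P" and X: "\<And>a. a \<in> E \<Longrightarrow> discrete_random_variable P (X a)" and c: "c > 0"
    and ent: "\<And>A. A \<subseteq> E \<Longrightarrow> \<exists>h. has_shannon_entropy P (joint_var X A) h \<and> real (r A) = c * h"
    using assms unfolding entropic_def by auto
  have E: "finite E" using assms by (simp add: entropic_def matroid_def)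
  interpret prob_space P by fact
  interpret information_space P 2 by unfold_locales simp
  have Y: "joint_var X A \<in> P \<rightarrow>\<^sub>M count_space UNIV" if "A \<subseteq> E" for A
  proof -
    have "joint_var X A \<in> P \<rightarrow>\<^sub>M count_space (joint_var X A ` space P)"
      using ent[OF that] unfolding has_shannon_entropy_def finite_entropy_def distributed_def by blast
    moreover have "id \<in> count_space (joint_var X A ` space P) \<rightarrow>\<^sub>M count_space UNIV" by simp
    ultimately have "id \<circ> joint_var X A \<in> P \<rightarrow>\<^sub>M count_space UNIV" by (rule measurable_comp)
    then show ?thesis by simp
  qed
  \<comment> \<open>Finiteness of \<open>E\<close> keeps the range of the joint variable
    countable.\<close>
  have "joint_var X E ` space P \<subseteq> PiE E (\<lambda>a. X a ` space P)"
    by (auto simp: joint_var_def)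
  moreover have "countable (PiE E (\<lambda>a. X a ` space P))"
    using X E by (intro countable_PiE) (auto simp: discrete_random_variable_def)
  ultimately have "countable (joint_var X E ` space P)" by (rule countable_subset)
  then obtain D where D: "measure_pmf D = distr P (count_space UNIV) (joint_var X E)"
    using pmf_of_discrete_random_variable[OF P Y[OF order_refl]] by blast
  have marg: "measure_pmf (marginal D A) = distr P (count_space UNIV) (joint_var X A)" if "A \<subseteq> E" for A
  proof -
    have "(\<lambda>t. restrict t A) \<circ> joint_var X E = joint_var X A"
      using that by (auto simp: joint_var_def fun_eq_iff)
    then show ?thesis
      unfolding map_pmf_rep_eq D using Y[OF order_refl] by (subst distr_distr) auto
  qed
  show thesis
  proof (rule that)
    \<comment> \<open>Division by \<open>ln 2\<close> passes to natural logarithms.\<close>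
    show "c / ln 2 > 0" using c by simp
    fix A assume A: "A \<subseteq> E"
    obtain h where h: "has_shannon_entropy P (joint_var X A) h" "real (r A) = c * h"
      using ent[OF A] by blast
    note H = has_shannon_entropy_pmf[OF P marg[OF A] Y[OF A] h(1)]
    show "integrable (measure_pmf D) (\<lambda>t. ln (pmf (marginal D A) (restrict t A)))"
      using H(1) by simp
    have "real (r A) = c / ln 2 * (ln 2 * h)" using h(2) by simp
    then show "real (r A) = - (c / ln 2) * (\<integral>t. ln (pmf (marginal D A) (restrict t A)) \<partial>measure_pmf D)"
      unfolding H(2) by simp
  qed
qed

text \<open>Equal ranks mean vanishing conditional entropy, additive ranks mean vanishing mutual
  information, and nonzero rank excludes a constant variable.\<close>

lemma entropic_supportE:
  assumes "entropic TYPE('w) TYPE('v) E r"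
  obtains D :: "('a \<Rightarrow> 'v) pmf" where
    "\<And>A B t t' a. A \<subseteq> B \<Longrightarrow> B \<subseteq> E \<Longrightarrow> r A = r B \<Longrightarrow> t \<in> set_pmf D \<Longrightarrow> t' \<in> set_pmf D \<Longrightarrow>
      \<forall>x\<in>A. t x = t' x \<Longrightarrow> a \<in> B \<Longrightarrow> t a = t' a"
    "\<And>A B. A \<subseteq> E \<Longrightarrow> B \<subseteq> E \<Longrightarrow> r (A \<union> B) = r A + r B \<Longrightarrow>
      map_pmf (\<lambda>t. (restrict t A, restrict t B)) D = pair_pmf (marginal D A) (marginal D B)"
    "\<And>a. a \<in> E \<Longrightarrow> r {a} \<noteq> 0 \<Longrightarrow> \<exists>t\<in>set_pmf D. \<exists>t'\<in>set_pmf D. t a \<noteq> t' a"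
proof -
  obtain D :: "('a \<Rightarrow> 'v) pmf" and c :: real where c: "c > 0"
    and int: "\<And>A. A \<subseteq> E \<Longrightarrow> integrable (measure_pmf D) (\<lambda>t. ln (pmf (marginal D A) (restrict t A)))"
    and r: "\<And>A. A \<subseteq> E \<Longrightarrow>
      real (r A) = - c * (\<integral>t. ln (pmf (marginal D A) (restrict t A)) \<partial>measure_pmf D)"
    by (rule entropic_pmf[OF assms]) (rule that)
  let ?g = "\<lambda>A t. pmf (marginal D A) (restrict t A)"
  have g: "?g A t = measure D {s. \<forall>a\<in>A. s a = t a}" for A t
    by (simp add: pmf_map vimage_def restrict_eq_iff)
  have pos: "?g A t > 0" if "t \<in> set_pmf D" for A t
    using that by (intro pmf_positive) auto
  show thesis
  proof (rule that)
    fix A B t t' a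
    assume AB: "A \<subseteq> B" "B \<subseteq> E" "r A = r B" and t: "t \<in> set_pmf D" "t' \<in> set_pmf D"
      and eq: "\<forall>x\<in>A. t x = t' x" and a: "a \<in> B"
    have AE: "A \<subseteq> E" using AB by blast
    \<comment> \<open>The mean of \<open>?k\<close> is the conditional entropy of \<open>B\<close>
      given \<open>A\<close>. It is zero and \<open>?k\<close> is nonnegative on the support, so
      \<open>?k\<close> vanishes there.\<close>
    let ?k = "\<lambda>t. ln (?g A t) - ln (?g B t)"
    have "?g B t \<le> ?g A t" for t
      unfolding g using AB(1) by (intro measure_pmf.finite_measure_mono) auto
    then have nn: "AE t in measure_pmf D. 0 \<le> ?k t"
      using pos by (auto simp: AE_measure_pmf_iff)
    have "(\<integral>t. ?k t \<partial>measure_pmf D) = 0"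
      using int[OF AE] int[OF AB(2)] r[OF AE] r[OF AB(2)] AB(3) c by simp
    then have "AE t in measure_pmf D. ?k t = 0"
      using integral_nonneg_eq_0_iff_AE[OF Bochner_Integration.integrable_diff[OF int[OF AE] int[OF AB(2)]] nn]
      by simp
    then have "?g A t = ?g B t"
      using t(1) pos by (auto simp: AE_measure_pmf_iff)
    show "t a = t' a"
    \<comment> \<open>Otherwise \<open>t'\<close> adds its positive mass to the event for
      \<open>A\<close> without belonging to the event for \<open>B\<close>, yet both have equal
      mass.\<close>
    proof (rule ccontr)
      assume "t a \<noteq> t' a"
      then have "t' a \<noteq> t a" by simp
      then have "?g B t + pmf D t' = measure D ({s. \<forall>a\<in>B. s a = t a} \<union> {t'})"
        unfolding g using a by (subst measure_pmf.finite_measure_Union) (auto simp: pmf.rep_eq)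
      also have "\<dots> \<le> ?g A t"
        unfolding g using AB(1) eq by (intro measure_pmf.finite_measure_mono) auto
      finally show False using \<open>?g A t = ?g B t\<close> pmf_positive[OF t(2)] by simp
    qed
  next
    fix A B assume AB: "A \<subseteq> E" "B \<subseteq> E" "r (A \<union> B) = r A + r B"
    let ?J = "map_pmf (\<lambda>t. (restrict t A, restrict t B)) D"
    let ?Q = "pair_pmf (marginal D A) (marginal D B)"
    have J: "pmf ?J (restrict t A, restrict t B) = ?g (A \<union> B) t" for t
      unfolding g by (auto simp: pmf_map vimage_def restrict_eq_iff intro!: arg_cong[where f = "measure D"])
    \<comment> \<open>The mean of this log-ratio is the negative mutual information, which
      additivity of the ranks makes zero.\<close>
    have split: "ln (pmf ?Q (restrict t A, restrict t B) / pmf ?J (restrict t A, restrict t B)) =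
        ln (?g A t) + ln (?g B t) - ln (?g (A \<union> B) t)" if "t \<in> set_pmf D" for t
      unfolding J pmf_pair using pos[OF that, of A] pos[OF that, of B] pos[OF that, of "A \<union> B"]
      by (simp add: ln_div ln_mult)
    have sum_int: "integrable (measure_pmf D) (\<lambda>t. ln (?g A t) + ln (?g B t) - ln (?g (A \<union> B) t))"
      using int AB by simp
    have "?J = ?Q"
    proof (rule pmf_eq_if_relative_entropy_zero)
      show "set_pmf ?J \<subseteq> set_pmf ?Q" by auto
      show "integrable (measure_pmf ?J) (\<lambda>x. ln (pmf ?Q x / pmf ?J x))"
        unfolding integrable_map_pmf_eq
        by (rule integrable_cong_AE_imp[OF sum_int]) (auto simp: AE_measure_pmf_iff split)
      have "(\<integral>x. ln (pmf ?Q x / pmf ?J x) \<partial>measure_pmf ?J) =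
          (\<integral>t. ln (?g A t) + ln (?g B t) - ln (?g (A \<union> B) t) \<partial>measure_pmf D)"
        unfolding integral_map_pmf
        by (rule integral_cong_AE) (auto simp: AE_measure_pmf_iff split)
      also have "\<dots> = (\<integral>t. ln (?g A t) \<partial>measure_pmf D) + (\<integral>t. ln (?g B t) \<partial>measure_pmf D) -
          (\<integral>t. ln (?g (A \<union> B) t) \<partial>measure_pmf D)"
        using int AB by simp
      also have "\<dots> = 0"
      proof -
        have "c * ((\<integral>t. ln (?g A t) \<partial>measure_pmf D) + (\<integral>t. ln (?g B t) \<partial>measure_pmf D) -
          (\<integral>t. ln (?g (A \<union> B) t) \<partial>measure_pmf D)) = real (r (A \<union> B)) - real (r A) - real (r B)"
          using AB r[of A] r[of B] r[of "A \<union> B"] by (simp add: algebra_simps)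
        then show ?thesis using AB(3) c by simp
      qed
      finally show "(\<integral>x. ln (pmf ?Q x / pmf ?J x) \<partial>measure_pmf ?J) = 0" .
    qed
    then show "?J = ?Q" .
  next
    fix a assume a: "a \<in> E" "r {a} \<noteq> 0"
    show "\<exists>t\<in>set_pmf D. \<exists>t'\<in>set_pmf D. t a \<noteq> t' a"
    proof (rule ccontr)
      assume "\<not> ?thesis"
      \<comment> \<open>A constant coordinate has mass one, logarithm zero and hence rank
        zero.\<close>
      then have "?g {a} t = 1" if "t \<in> set_pmf D" for t
        unfolding g using that by (auto simp: measure_pmf.prob_eq_1 AE_measure_pmf_iff)
      then have "(\<integral>t. ln (?g {a} t) \<partial>measure_pmf D) = (\<integral>t. 0 \<partial>measure_pmf D)"
        by (intro integral_cong_AE) (auto simp: AE_measure_pmf_iff)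
      then show False using r[of "{a}"] a by simp
    qed
  qed
qed

section \<open>Lines of the Dowling geometry\<close>

lemma finite_dowling_ground: "finite S \<Longrightarrow> finite (dowling_ground S)"
proof -
  assume "finite S"
  then have "finite ((\<lambda>(s, i). Copy s i) ` (S \<times> {1, 2, 3 :: nat}))" by simp
  then have "finite (Base ` {1, 2, 3} \<union> (\<lambda>(s, i). Copy s i) ` (S \<times> {1, 2, 3 :: nat}))"
    by simp
  then show ?thesis
    by (rule rev_finite_subset) (force simp: dowling_ground_def)
qed

lemma dowling_rank_eqI:
  assumes "finite S" "A \<subseteq> dowling_ground S" "I \<subseteq> A" "dowling_indep S R I"
    and "\<And>J. J \<subseteq> A \<Longrightarrow> dowling_indep S R J \<Longrightarrow> card J \<le> card I"
  shows "dowling_rank S R A = card I"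
  unfolding dowling_rank_def
proof (rule Max_eqI)
  have "finite A" using assms(1,2) finite_dowling_ground finite_subset by blast
  then have "finite {I. I \<subseteq> A \<and> dowling_indep S R I}" by simp
  then show "finite (card ` {I. I \<subseteq> A \<and> dowling_indep S R I})" by simp
qed (use assms in auto)

lemma dowling_rank_indep:
  assumes "finite S" "dowling_indep S R A"
  shows "dowling_rank S R A = card A"
proof (rule dowling_rank_eqI)
  have "finite A"
    using assms finite_dowling_ground finite_subset unfolding dowling_indep_def by blast
  then show "card J \<le> card A" if "J \<subseteq> A" for J using that by (rule card_mono)
qed (use assms in \<open>auto simp: dowling_indep_def\<close>)

lemma dowling_rank_le_two:
  assumes "finite S" "A \<subseteq> dowling_ground S" "card A \<le> 2"
  shows "dowling_rank S R A = card A"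
  using assms by (intro dowling_rank_indep) (auto simp: dowling_indep_def)

text \<open>Two points are always independent, and the only three-element subset of \<open>A\<close>
  is the collinear set \<open>A\<close> itself.\<close>

lemma dowling_rank_line:
  assumes "finite S" "A \<subseteq> dowling_ground S" "card A = 3" "L \<in> dowling_lines S R" "A \<subseteq> L"
  shows "dowling_rank S R A = 2"
proof -
  obtain x y z where A: "A = {x, y, z}" "x \<noteq> y" "x \<noteq> z" "y \<noteq> z"
    using assms(3) by (auto simp: card_3_iff)
  have "dowling_rank S R A = card {x, y}"
  proof (rule dowling_rank_eqI[OF assms(1,2)])
    show "dowling_indep S R {x, y}"
      using A assms(2) by (auto simp: dowling_indep_def)
    fix J assume J: "J \<subseteq> A" "dowling_indep S R J"
    have "finite A" using A by simp
    then have "J = A" if "card J = 3" using that J(1) assms(3) by (metis card_subset_eq)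
    then have "card J \<noteq> 3" using J(2) assms(3-5) by (auto simp: dowling_indep_def)
    then show "card J \<le> card {x, y}" using J(2) A by (auto simp: dowling_indep_def)
  qed (use A in auto)
  then show ?thesis using A by simp
qed

text \<open>Gives the three bases rank 3, the source of their mutual independence.\<close>

lemma bases_not_collinear:
  assumes "L \<in> dowling_lines S R"
  shows "\<not> {Base 1, Base 2, Base 3} \<subseteq> L"
proof
  assume "{Base 1, Base 2, Base 3} \<subseteq> L"
  then have "Base 1 \<in> L" "Base 2 \<in> L" "Base 3 \<in> L" by simp_all
  with assms show False
    unfolding dowling_lines_def by (elim UnE insertE emptyE CollectE exE conjE) simp_all
qed

lemma base_copy_in_line:
  assumes "i \<in> {1, 2, 3}"
  shows "{Base i, Base (nxt i)} \<union> {Copy s i |s. s \<in> S} \<in> dowling_lines S R"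
proof -
  have "i = 1 \<or> i = 2 \<or> i = 3" using assms by simp
  then show ?thesis unfolding dowling_lines_def by (elim disjE) simp_all
qed

lemma relator_in_line:
  assumes "i \<in> {1, 2, 3}" "[s'', s', s] \<in> R"
  shows "{Copy s i, Copy s' (nxt i), Copy s'' (nxt (nxt i))} \<in> dowling_lines S R"
proof -
  have "(i, nxt i, nxt (nxt i)) \<in> {(1, 2, 3), (2, 3, 1), (3, 1, 2)}" using assms(1) by auto
  with assms(2) show ?thesis
    unfolding dowling_lines_def by (intro UnI2 CollectI exI conjI) (rule HOL.refl)
qed

lemma nxt_neq: "i \<in> {1, 2, 3} \<Longrightarrow> nxt i \<noteq> i" "i \<in> {1, 2, 3} \<Longrightarrow> nxt (nxt i) \<noteq> i"
  by auto

theorem theorem4p5: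
  fixes G :: "('g, 'b) monoid_scheme" and \<iota> :: "'s \<Rightarrow> 'g"
    and e :: 's and sinv :: "'s \<Rightarrow> 's" and S :: "'s set" and R :: "'s list set"
  assumes "symmetric_triangular e sinv S R"
    and "has_presentation G \<iota> S (insert [e] R)"
    and "entropic TYPE('w) TYPE('v) (dowling_ground S) (dowling_rank S R)"
  shows "\<exists>(n :: nat) \<rho>. \<rho> \<in> hom G (sym_group n) \<and>
    (\<forall>s\<in>S. \<forall>s'\<in>S. s \<noteq> s' \<longrightarrow> \<rho> (\<iota> s) \<noteq> \<rho> (\<iota> s'))"
proof -
  note triD = symmetric_triangularD[OF assms(1)]
  let ?E = "dowling_ground S" and ?r = "dowling_rank S R"
  obtain D :: "('s dowling_elem \<Rightarrow> 'v) pmf" where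
    det: "\<And>A B t t' a. A \<subseteq> B \<Longrightarrow> B \<subseteq> ?E \<Longrightarrow> ?r A = ?r B \<Longrightarrow> t \<in> set_pmf D \<Longrightarrow> t' \<in> set_pmf D \<Longrightarrow>
      \<forall>x\<in>A. t x = t' x \<Longrightarrow> a \<in> B \<Longrightarrow> t a = t' a"
    and ind: "\<And>A B. A \<subseteq> ?E \<Longrightarrow> B \<subseteq> ?E \<Longrightarrow> ?r (A \<union> B) = ?r A + ?r B \<Longrightarrow>
      map_pmf (\<lambda>t. (restrict t A, restrict t B)) D = pair_pmf (marginal D A) (marginal D B)"
    and two: "\<And>a. a \<in> ?E \<Longrightarrow> ?r {a} \<noteq> 0 \<Longrightarrow> \<exists>t\<in>set_pmf D. \<exists>t'\<in>set_pmf D. t a \<noteq> t' a"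
    by (rule entropic_supportE[OF assms(3)]) (rule that)
  let ?T = "set_pmf D"
  note rank2 = dowling_rank_le_two[OF triD(1)]
  have E: "Base i \<in> ?E" "s \<in> S \<Longrightarrow> Copy s i \<in> ?E" if "i \<in> {1, 2, 3}" for i s
    using that by (auto simp: dowling_ground_def)
  \<comment> \<open>Two points have rank two, the sum of their ranks, so the variables are
    independent; evaluation turns restrictions to singletons into values.\<close>
  have pair: "map_pmf (\<lambda>t. (t x, t y)) D = pair_pmf (map_pmf (\<lambda>t. t x) D) (map_pmf (\<lambda>t. t y) D)"
    if "x \<in> ?E" "y \<in> ?E" "x \<noteq> y" for x y
  proof -
    have "map_pmf (\<lambda>t. (restrict t {x}, restrict t {y})) D = pair_pmf (marginal D {x}) (marginal D {y})"
      using that rank2[of "{x}"] rank2[of "{y}"] rank2[of "{y, x}"] by (intro ind) auto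
    then have "map_pmf (\<lambda>(u, v). (u x, v y)) (map_pmf (\<lambda>t. (restrict t {x}, restrict t {y})) D) =
        pair_pmf (map_pmf (\<lambda>u. u x) (marginal D {x})) (map_pmf (\<lambda>v. v y) (marginal D {y}))"
      by (simp only: map_pair)
    then show ?thesis by (simp add: map_pmf_comp)
  qed
  have free: "jointly_free ?T (\<lambda>t. t x) (\<lambda>t. t y)" if "x \<in> ?E" "y \<in> ?E" "x \<noteq> y" for x y
    unfolding jointly_free_def
  proof (intro ballI)
    fix t t' assume "t \<in> ?T" "t' \<in> ?T"
    \<comment> \<open>The support of a product law is the product of the supports.\<close>
    then have "(t x, t' y) \<in> set_pmf (map_pmf (\<lambda>t. (t x, t y)) D)"
      unfolding pair[OF that] by simp
    then show "\<exists>t''\<in>?T. t'' x = t x \<and> t'' y = t' y" by auto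
  qed
  have line: "determine ?T (\<lambda>t. t x) (\<lambda>t. t y) (\<lambda>t. t z)"
    if L: "L \<in> dowling_lines S R" "{x, y, z} \<subseteq> L" and E': "{x, y, z} \<subseteq> ?E"
      and ne: "x \<noteq> y" "x \<noteq> z" "y \<noteq> z" for x y z L
    unfolding determine_def
  proof (intro ballI impI)
    fix t t' assume t: "t \<in> ?T" "t' \<in> ?T" "t x = t' x" "t y = t' y"
    have "?r {x, y} = 2" using rank2[of "{x, y}"] E' ne by simp
    moreover have "?r {x, y, z} = 2" using dowling_rank_line[OF triD(1) E' _ L] ne by simp
    ultimately show "t z = t' z"
      using t by (intro det[of "{x, y}" "{x, y, z}" t t' z]) (use E' in auto)
  qed
  have base_line: "determine ?T (\<lambda>t. t x) (\<lambda>t. t y) (\<lambda>t. t z)"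
    if "i \<in> {1, 2, 3}" "{x, y, z} \<subseteq> {Base i, Base (nxt i)} \<union> {Copy s i |s. s \<in> S}"
      and "x \<noteq> y" "x \<noteq> z" "y \<noteq> z" for x y z i
    using that(2) E[OF that(1)] E[OF nxt_closed[OF that(1)]]
    by (intro line[OF base_copy_in_line[OF that(1)] that(2) _ that(3-5)]) auto
  have latin: "latin_triple ?T (\<lambda>t. t (Base i)) (\<lambda>t. t (Base (nxt i))) (\<lambda>t. t (Copy s i))"
    if i: "i \<in> {1, 2, 3}" and s: "s \<in> S" for i s
    unfolding latin_triple_def
    using E[OF i] E[OF nxt_closed[OF i]] nxt_neq[OF i] s
    by (intro conjI free base_line[OF i]) auto
  have e: "e \<in> S" by (rule triD(2))
  have B: "Base 1 \<in> ?E" "Base 2 \<in> ?E" "Base 3 \<in> ?E" "Copy e 1 \<in> ?E"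
    using E[of 1] E[of 2] E[of 3] e by auto
  have l: "latin_triple ?T (\<lambda>t. t (Base 2)) (\<lambda>t. t (Base 1)) (\<lambda>t. t (Copy e 1))"
    using latin_triple_commute[OF latin[OF _ e, of 1]] by simp
  have fin: "finite ((\<lambda>t. t (Base 1)) ` ?T)"
  \<comment> \<open>The variable in the role of \<open>g\<close> is the one shown to have finitely
    many values, so \<open>Base 1\<close> takes that role.\<close>
  proof (rule finite_values_if_latin[where f = "\<lambda>t. t (Base 2)" and h = "\<lambda>t. t (Copy e 1)"])
    show "t (Copy e 1) = t' (Copy e 1)"
      if "t \<in> ?T" "t' \<in> ?T" "t (Base 2) = t' (Base 2)" "t (Base 1) = t' (Base 1)" for t t'
      using determineD[OF latin_tripleD(4)[OF l]] that by blast
    show "t (Base 1) = t' (Base 1)"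
      if "t \<in> ?T" "t' \<in> ?T" "t (Base 2) = t' (Base 2)" "t (Copy e 1) = t' (Copy e 1)" for t t'
      using determineD[OF latin_tripleD(5)[OF l]] that by blast
  qed (rule pair; use B in simp)+
  have "?r {Base 1} \<noteq> 0" using rank2[of "{Base 1}"] B by simp
  from two[OF B(1) this] obtain t t' where t: "t \<in> ?T" "t' \<in> ?T" "t (Base 1) \<noteq> t' (Base 1)"
    by blast
  have free3: "\<exists>t\<in>?T. t (Base 1) = t1 (Base 1) \<and> t (Base 2) = t2 (Base 2) \<and> t (Base 3) = t3 (Base 3)"
    if t123: "t1 \<in> ?T" "t2 \<in> ?T" "t3 \<in> ?T" for t1 t2 t3
  proof -
    let ?A = "{Base 1, Base 2 :: 's dowling_elem}" and ?B = "{Base 3 :: 's dowling_elem}"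
    have "dowling_indep S R {Base 1, Base 2, Base 3}"
      using B bases_not_collinear by (auto simp: dowling_indep_def)
    \<comment> \<open>Rank 3 = 2 + 1 makes the third base independent of the pair of the first two,
      which are jointly free by \<open>free\<close>.\<close>
    then have "?r (?A \<union> ?B) = ?r ?A + ?r ?B"
      using dowling_rank_indep[OF triD(1)] rank2[of ?A] rank2[of ?B] B by (simp add: insert_commute)
    then have p: "map_pmf (\<lambda>t. (restrict t ?A, restrict t ?B)) D = pair_pmf (marginal D ?A) (marginal D ?B)"
      using B by (intro ind) auto
    obtain t12 where t12: "t12 \<in> ?T" "t12 (Base 1) = t1 (Base 1)" "t12 (Base 2) = t2 (Base 2)"
      using jointly_freeE[OF free[OF B(1,2)] t123(1,2)] by auto
    have "(restrict t12 ?A, restrict t3 ?B) \<in> set_pmf (map_pmf (\<lambda>t. (restrict t ?A, restrict t ?B)) D)"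
      unfolding p using t12(1) t123(3) by simp
    then obtain t where "t \<in> ?T" "restrict t12 ?A = restrict t ?A" "restrict t3 ?B = restrict t ?B"
      by auto
    then have "t (Base 1) = t1 (Base 1) \<and> t (Base 2) = t2 (Base 2) \<and> t (Base 3) = t3 (Base 3)"
      using t12 unfolding restrict_eq_iff by simp
    then show ?thesis using \<open>t \<in> ?T\<close> by blast
  qed
  show ?thesis
  proof (rule configuration_hom[where T = ?T and b = "\<lambda>i t. t (Base i)" and c = "\<lambda>s i t. t (Copy s i)",
        OF assms(1,2) fin t])
    show "latin_triple ?T (\<lambda>t. t (Base i)) (\<lambda>t. t (Base (nxt i))) (\<lambda>t. t (Copy s i))"
      if "i \<in> {1, 2, 3}" "s \<in> S" for i s
      using that by (rule latin)
    show "\<exists>t\<in>?T. t (Base 1) = t1 (Base 1) \<and> t (Base 2) = t2 (Base 2) \<and> t (Base 3) = t3 (Base 3)"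
      if "t1 \<in> ?T" "t2 \<in> ?T" "t3 \<in> ?T" for t1 t2 t3
      using that by (rule free3)
  next
    fix i :: nat and s s' s'' assume i: "i \<in> {1, 2, 3}" and R: "[s'', s', s] \<in> R"
    have S: "s \<in> S" "s' \<in> S" "s'' \<in> S" using triD(9)[OF R] by auto
    note i' = nxt_closed[OF i] nxt_closed[OF nxt_closed[OF i]]
    have ne: "nxt i \<noteq> i" "nxt (nxt i) \<noteq> i" "nxt (nxt i) \<noteq> nxt i"
      using nxt_neq[OF i] nxt_neq[OF i'(1)] by auto
    show "jointly_free ?T (\<lambda>t. t (Copy s i)) (\<lambda>t. t (Copy s' (nxt i)))"
      using E(2)[OF i S(1)] E(2)[OF i'(1) S(2)] ne by (intro free) auto
    show "determine ?T (\<lambda>t. t (Copy s i)) (\<lambda>t. t (Copy s' (nxt i))) (\<lambda>t. t (Copy s'' (nxt (nxt i))))"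
      using E(2)[OF i S(1)] E(2)[OF i'(1) S(2)] E(2)[OF i'(2) S(3)] ne
      by (intro line[OF relator_in_line[OF i R]]) auto
  next
    fix s s' assume "s \<in> S" "s' \<in> S" "s \<noteq> s'"
    \<comment> \<open>Two distinct copies with index 1 are collinear with
      \<open>Base 1\<close>.\<close>
    then show "determine ?T (\<lambda>t. t (Copy s 1)) (\<lambda>t. t (Copy s' 1)) (\<lambda>t. t (Base 1))"
      by (intro base_line[of 1]) auto
  qed
qed

end
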